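(* Let $K$ be any field, $R$ a $K$-algebra, and $J$ an ideal of $R$. If $J$ and $R/J$ are both locally f.d.ss with bounded index of nilpotence, then $R$ is locally f.d.ss with bounded index of nilpotence.
   Context: All algebras are associative but not necessarily unital $K$-algebras; ideals are two-sided ring ideals that are also $K$-subspaces. A $K$-algebra $R$ is locally f.d.ss if every finite subset of $R$ is contained in a subalgebra of $R$ that is a finite dimensional semisimple $K$-algebra. A ring $R$ has bounded index of nilpotence if there is a positive integer $n$ such that $x^n = 0$ for every nilpotent $x \in R$. *)

theory Defs
  imports Main
begin

record ('k, 'a) kalg =
  carr :: "'a set"
  pls  :: "'a \<Rightarrow> 'a \<Rightarrow> 'a"
  tms  :: "'a \<Rightarrow> 'a \<Rightarrow> 'a"
  zro  :: "'a"
  ngt  :: "'a \<Rightarrow> 'a"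
  scl  :: "'k \<Rightarrow> 'a \<Rightarrow> 'a"

definition is_kalg :: "('k::field, 'a) kalg \<Rightarrow> bool" where
  "is_kalg A \<longleftrightarrow>
     zro A \<in> carr A \<and>
     (\<forall>x\<in>carr A. \<forall>y\<in>carr A. pls A x y \<in> carr A) \<and>
     (\<forall>x\<in>carr A. \<forall>y\<in>carr A. tms A x y \<in> carr A) \<and>
     (\<forall>x\<in>carr A. ngt A x \<in> carr A) \<and>
     (\<forall>c. \<forall>x\<in>carr A. scl A c x \<in> carr A) \<and>
     (\<forall>x\<in>carr A. \<forall>y\<in>carr A. \<forall>z\<in>carr A. pls A (pls A x y) z = pls A x (pls A y z)) \<and>
     (\<forall>x\<in>carr A. \<forall>y\<in>carr A. pls A x y = pls A y x) \<and>
     (\<forall>x\<in>carr A. pls A (zro A) x = x) \<and>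
     (\<forall>x\<in>carr A. pls A (ngt A x) x = zro A) \<and>
     (\<forall>x\<in>carr A. \<forall>y\<in>carr A. \<forall>z\<in>carr A. tms A (tms A x y) z = tms A x (tms A y z)) \<and>
     (\<forall>x\<in>carr A. \<forall>y\<in>carr A. \<forall>z\<in>carr A. tms A x (pls A y z) = pls A (tms A x y) (tms A x z)) \<and>
     (\<forall>x\<in>carr A. \<forall>y\<in>carr A. \<forall>z\<in>carr A. tms A (pls A x y) z = pls A (tms A x z) (tms A y z)) \<and>
     (\<forall>x\<in>carr A. scl A 1 x = x) \<and>
     (\<forall>a b. \<forall>x\<in>carr A. scl A (a * b) x = scl A a (scl A b x)) \<and>
     (\<forall>a b. \<forall>x\<in>carr A. scl A (a + b) x = pls A (scl A a x) (scl A b x)) \<and>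
     (\<forall>a. \<forall>x\<in>carr A. \<forall>y\<in>carr A. scl A a (pls A x y) = pls A (scl A a x) (scl A a y)) \<and>
     (\<forall>a. \<forall>x\<in>carr A. \<forall>y\<in>carr A. scl A a (tms A x y) = tms A (scl A a x) y) \<and>
     (\<forall>a. \<forall>x\<in>carr A. \<forall>y\<in>carr A. scl A a (tms A x y) = tms A x (scl A a y))"

definition subalg :: "('k::field, 'a) kalg \<Rightarrow> 'a set \<Rightarrow> bool" where
  "subalg A S \<longleftrightarrow> S \<subseteq> carr A \<and> zro A \<in> S \<and>
     (\<forall>x\<in>S. \<forall>y\<in>S. pls A x y \<in> S) \<and> (\<forall>x\<in>S. ngt A x \<in> S) \<and>
     (\<forall>c. \<forall>x\<in>S. scl A c x \<in> S) \<and> (\<forall>x\<in>S. \<forall>y\<in>S. tms A x y \<in> S)"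

definition ideal :: "('k::field, 'a) kalg \<Rightarrow> 'a set \<Rightarrow> bool" where
  "ideal A I \<longleftrightarrow> I \<subseteq> carr A \<and> zro A \<in> I \<and>
     (\<forall>x\<in>I. \<forall>y\<in>I. pls A x y \<in> I) \<and> (\<forall>x\<in>I. ngt A x \<in> I) \<and>
     (\<forall>c. \<forall>x\<in>I. scl A c x \<in> I) \<and>
     (\<forall>r\<in>carr A. \<forall>x\<in>I. tms A r x \<in> I \<and> tms A x r \<in> I)"

abbreviation restr :: "('k, 'a) kalg \<Rightarrow> 'a set \<Rightarrow> ('k, 'a) kalg" where
  "restr A S \<equiv> A\<lparr>carr := S\<rparr>"

definition cos :: "('k, 'a) kalg \<Rightarrow> 'a set \<Rightarrow> 'a \<Rightarrow> 'a set" where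
  "cos A J x = {y \<in> carr A. pls A y (ngt A x) \<in> J}"

definition rep :: "'a set \<Rightarrow> 'a" where
  "rep X = (SOME x. x \<in> X)"

definition quot :: "('k, 'a) kalg \<Rightarrow> 'a set \<Rightarrow> ('k, 'a set) kalg" where
  "quot A J = \<lparr> carr = cos A J ` carr A,
     pls = (\<lambda>X Y. cos A J (pls A (rep X) (rep Y))),
     tms = (\<lambda>X Y. cos A J (tms A (rep X) (rep Y))),
     zro = cos A J (zro A),
     ngt = (\<lambda>X. cos A J (ngt A (rep X))),
     scl = (\<lambda>c X. cos A J (scl A c (rep X))) \<rparr>"

fun lincomb :: "('k, 'a) kalg \<Rightarrow> 'k list \<Rightarrow> 'a list \<Rightarrow> 'a" where
  "lincomb A (c # cs) (b # bs) = pls A (scl A c b) (lincomb A cs bs)"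
| "lincomb A _ _ = zro A"

definition fin_dim :: "('k::field, 'a) kalg \<Rightarrow> bool" where
  "fin_dim A \<longleftrightarrow> (\<exists>bs. set bs \<subseteq> carr A \<and>
     (\<forall>x\<in>carr A. \<exists>cs. length cs = length bs \<and> x = lincomb A cs bs))"

text \<open>Products of nonempty lists; nilpotent ideals; semisimplicity of a
  finite-dimensional algebra = its radical (largest nilpotent ideal) is zero.\<close>

fun lprod :: "('k, 'a) kalg \<Rightarrow> 'a list \<Rightarrow> 'a" where
  "lprod A [] = zro A"
| "lprod A [x] = x"
| "lprod A (x # xs) = tms A x (lprod A xs)"

definition nilpotent_ideal :: "('k::field, 'a) kalg \<Rightarrow> 'a set \<Rightarrow> bool" where
  "nilpotent_ideal A I \<longleftrightarrow> ideal A I \<and>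
     (\<exists>n>0. \<forall>xs. length xs = n \<and> set xs \<subseteq> I \<longrightarrow> lprod A xs = zro A)"

definition fd_semisimple :: "('k::field, 'a) kalg \<Rightarrow> bool" where
  "fd_semisimple A \<longleftrightarrow> fin_dim A \<and> (\<forall>I. nilpotent_ideal A I \<longrightarrow> I = {zro A})"

definition locally_fdss :: "('k::field, 'a) kalg \<Rightarrow> bool" where
  "locally_fdss A \<longleftrightarrow> (\<forall>F. finite F \<and> F \<subseteq> carr A \<longrightarrow>
     (\<exists>S. subalg A S \<and> F \<subseteq> S \<and> fd_semisimple (restr A S)))"

text \<open>Powers x^n for n \<ge> 1; bounded index of nilpotence.\<close>

fun apow :: "('k, 'a) kalg \<Rightarrow> 'a \<Rightarrow> nat \<Rightarrow> 'a" where
  "apow A x 0 = zro A"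
| "apow A x (Suc 0) = x"
| "apow A x (Suc (Suc n)) = tms A x (apow A x (Suc n))"

definition nilpotent_elt :: "('k, 'a) kalg \<Rightarrow> 'a \<Rightarrow> bool" where
  "nilpotent_elt A x \<longleftrightarrow> (\<exists>m>0. apow A x m = zro A)"

definition bounded_nil_index :: "('k, 'a) kalg \<Rightarrow> bool" where
  "bounded_nil_index A \<longleftrightarrow> (\<exists>n>0. \<forall>x\<in>carr A. nilpotent_elt A x \<longrightarrow> apow A x n = zro A)"

end

theory Submission
  imports Defs
begin

text \<open>
  A finite-dimensional algebra has no nonzero nilpotent ideal iff it is von Neumann regular, so
  ``locally f.d.ss'' means ``locally finite-dimensional regular''.

  Suppose the nilpotent elements \<open>x\<close> of a regular ideal \<open>J\<close> satisfy \<open>x\<^sup>n = 0\<close>. If \<open>x\<^bsup>n-1\<^esup> \<noteq> 0\<close>,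
  regularity produces a system of \<open>n\<close> by \<open>n\<close> matrix units in \<open>J\<close> whose unit \<open>e\<close> fixes \<open>x\<^bsup>n-1\<^esup>\<close>, and the
  bound on the index forces \<open>e\<close> to be central in the whole algebra. Hence the ideal \<open>M\<close> generated by
  the central idempotents in \<open>J\<close> contains all these powers, and \<open>J / M\<close> has index at most \<open>n - 1\<close>.

  An extension of a locally f.d.ss algebra by such an \<open>M\<close> is locally f.d.ss: a central idempotent
  \<open>e\<close> of \<open>M\<close> absorbs the finitely many structure defects of a finite-dimensional lift, and the algebra
  splits as \<open>eR \<times> (1 - e)R\<close>. Induction on the index of \<open>J\<close> modulo an ideal \<open>I\<close> then descends from
  \<open>I = J\<close> to \<open>I = 0\<close>.
\<close>

section \<open>Linear algebra in an algebra with carrier\<close>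

text \<open>Regularity of single elements passes to extensions; the difficulty is a
  finite-dimensional subalgebra closed under quasi-inverses. A lift from \<open>R / J\<close>
  multiplies correctly only modulo \<open>J\<close>. An idempotent \<open>e\<close> that absorbs the
  errors helps when it is central, since then x -> x - e x is multiplicative; for other idempotents
  this fails in general, and \<open>J\<close> may lack central ones. Bounded index supplies them for
  the top layer only. A nonzero x^(n-1) yields a full n by n block, and for a noncentral unit
  \<open>e\<close> an element (1 - e) y z would prolong the nilpotent chain to index n + 1. Elements
  of lower index become the top layer once these blocks are factored out, hence an induction. The
  layers are ideals of the one algebra \<open>R\<close> and not iterated quotients: the elements of
  a quotient are sets, so its type would change at every step. Each step visits one quotient and
  pulls its result back.\<close>

locale k_algebra =
  fixes A :: "('k::field, 'a) kalg"
  assumes kalg: "is_kalg A"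
begin

abbreviation add (infixl "\<oplus>" 65) where "x \<oplus> y \<equiv> pls A x y"
abbreviation mul (infixl "\<odot>" 70) where "x \<odot> y \<equiv> tms A x y"
abbreviation zer ("\<zero>") where "\<zero> \<equiv> zro A"
abbreviation neg ("\<ominus> _" [81] 80) where "\<ominus> x \<equiv> ngt A x"
abbreviation smul (infixr "\<bullet>" 75) where "c \<bullet> x \<equiv> scl A c x"
abbreviation C where "C \<equiv> carr A"

lemma closed [simp, intro]:
  "\<zero> \<in> C" "x \<in> C \<Longrightarrow> y \<in> C \<Longrightarrow> x \<oplus> y \<in> C" "x \<in> C \<Longrightarrow> y \<in> C \<Longrightarrow> x \<odot> y \<in> C"
  "x \<in> C \<Longrightarrow> \<ominus> x \<in> C" "x \<in> C \<Longrightarrow> c \<bullet> x \<in> C"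
  using kalg unfolding is_kalg_def by simp_all

lemma add_assoc: "x \<in> C \<Longrightarrow> y \<in> C \<Longrightarrow> z \<in> C \<Longrightarrow> x \<oplus> y \<oplus> z = x \<oplus> (y \<oplus> z)"
  using kalg unfolding is_kalg_def by metis

lemma add_comm: "x \<in> C \<Longrightarrow> y \<in> C \<Longrightarrow> x \<oplus> y = y \<oplus> x"
  using kalg unfolding is_kalg_def by simp

lemma add_left_comm: "x \<in> C \<Longrightarrow> y \<in> C \<Longrightarrow> z \<in> C \<Longrightarrow> x \<oplus> (y \<oplus> z) = y \<oplus> (x \<oplus> z)"
  by (metis add_assoc add_comm)

lemma add_zero [simp]: "x \<in> C \<Longrightarrow> \<zero> \<oplus> x = x" "x \<in> C \<Longrightarrow> x \<oplus> \<zero> = x"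
  using kalg add_comm unfolding is_kalg_def by simp_all

lemma add_neg [simp]: "x \<in> C \<Longrightarrow> \<ominus> x \<oplus> x = \<zero>" "x \<in> C \<Longrightarrow> x \<oplus> \<ominus> x = \<zero>"
  using kalg add_comm unfolding is_kalg_def by simp_all

lemma add_neg_cancel [simp]:
  "x \<in> C \<Longrightarrow> y \<in> C \<Longrightarrow> \<ominus> x \<oplus> (x \<oplus> y) = y" "x \<in> C \<Longrightarrow> y \<in> C \<Longrightarrow> x \<oplus> (\<ominus> x \<oplus> y) = y"
  by (simp_all flip: add_assoc)

lemma mul_assoc: "x \<in> C \<Longrightarrow> y \<in> C \<Longrightarrow> z \<in> C \<Longrightarrow> x \<odot> y \<odot> z = x \<odot> (y \<odot> z)"
  using kalg unfolding is_kalg_def by simp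

lemma distrib:
  "x \<in> C \<Longrightarrow> y \<in> C \<Longrightarrow> z \<in> C \<Longrightarrow> x \<odot> (y \<oplus> z) = x \<odot> y \<oplus> x \<odot> z"
  "x \<in> C \<Longrightarrow> y \<in> C \<Longrightarrow> z \<in> C \<Longrightarrow> (x \<oplus> y) \<odot> z = x \<odot> z \<oplus> y \<odot> z"
  using kalg unfolding is_kalg_def by simp_all

lemma smul_one [simp]: "x \<in> C \<Longrightarrow> 1 \<bullet> x = x"
  using kalg unfolding is_kalg_def by simp

lemma smul_smul: "x \<in> C \<Longrightarrow> a \<bullet> (b \<bullet> x) = (a * b) \<bullet> x"
  using kalg unfolding is_kalg_def by simp

lemma smul_distrib:
  "x \<in> C \<Longrightarrow> (a + b) \<bullet> x = a \<bullet> x \<oplus> b \<bullet> x"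
  "x \<in> C \<Longrightarrow> y \<in> C \<Longrightarrow> a \<bullet> (x \<oplus> y) = a \<bullet> x \<oplus> a \<bullet> y"
  using kalg unfolding is_kalg_def by simp_all

lemma smul_mul:
  "x \<in> C \<Longrightarrow> y \<in> C \<Longrightarrow> (a \<bullet> x) \<odot> y = a \<bullet> (x \<odot> y)"
  "x \<in> C \<Longrightarrow> y \<in> C \<Longrightarrow> x \<odot> (a \<bullet> y) = a \<bullet> (x \<odot> y)"
  using kalg unfolding is_kalg_def by metis+

lemma neg_unique: "x \<in> C \<Longrightarrow> y \<in> C \<Longrightarrow> x \<oplus> y = \<zero> \<Longrightarrow> y = \<ominus> x"
  by (metis add_neg_cancel(1) add_zero(2) closed(4))

lemma idem_zero: "x \<in> C \<Longrightarrow> x \<oplus> x = x \<Longrightarrow> x = \<zero>"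
  by (metis add_neg_cancel(1) add_neg(1))

lemma mul_zero [simp]: "x \<in> C \<Longrightarrow> x \<odot> \<zero> = \<zero>" "x \<in> C \<Longrightarrow> \<zero> \<odot> x = \<zero>"
  by (rule idem_zero; simp flip: distrib(1)) (rule idem_zero; simp flip: distrib(2))

lemma smul_zero [simp]: "x \<in> C \<Longrightarrow> 0 \<bullet> x = \<zero>" "c \<bullet> \<zero> = \<zero>"
  by (rule idem_zero; simp flip: smul_distrib(1)) (rule idem_zero; simp flip: smul_distrib(2))

lemma neg_zero [simp]: "\<ominus> \<zero> = \<zero>"
  by (metis neg_unique add_zero(1) closed(1))

lemma neg_neg [simp]: "x \<in> C \<Longrightarrow> \<ominus> (\<ominus> x) = x"
  by (metis neg_unique add_neg(1) closed(4))

lemma neg_add: "x \<in> C \<Longrightarrow> y \<in> C \<Longrightarrow> \<ominus> (x \<oplus> y) = \<ominus> x \<oplus> \<ominus> y"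
  by (rule neg_unique [symmetric]) (simp_all add: add_assoc add_left_comm [of y])

lemma neg_mul:
  "x \<in> C \<Longrightarrow> y \<in> C \<Longrightarrow> (\<ominus> x) \<odot> y = \<ominus> (x \<odot> y)"
  "x \<in> C \<Longrightarrow> y \<in> C \<Longrightarrow> x \<odot> (\<ominus> y) = \<ominus> (x \<odot> y)"
  by (rule neg_unique; simp flip: distrib)+

lemma neg_eq_smul: "x \<in> C \<Longrightarrow> \<ominus> x = (-1) \<bullet> x"
  by (rule neg_unique [symmetric]) (simp_all, metis add.right_inverse smul_distrib(1) smul_one smul_zero(1))

lemmas ring_simps = add_assoc add_comm add_left_comm mul_assoc distrib neg_add neg_mul smul_mul smul_distrib

lemma diff_zero_iff: "x \<in> C \<Longrightarrow> y \<in> C \<Longrightarrow> x \<oplus> \<ominus> y = \<zero> \<longleftrightarrow> x = y"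
  by (metis add_neg(2) neg_unique neg_neg closed(4))

lemma diff_add [simp]: "x \<in> C \<Longrightarrow> y \<in> C \<Longrightarrow> x \<oplus> \<ominus> y \<oplus> y = x"
  by (simp add: add_assoc)

section \<open>Subspaces and spans of lists\<close>

definition subspace where
  "subspace W \<longleftrightarrow> W \<subseteq> C \<and> \<zero> \<in> W \<and> (\<forall>x\<in>W. \<forall>y\<in>W. x \<oplus> y \<in> W) \<and> (\<forall>c. \<forall>x\<in>W. c \<bullet> x \<in> W)"

lemma subspaceD:
  assumes "subspace W"
  shows "W \<subseteq> C" "\<zero> \<in> W" "x \<in> W \<Longrightarrow> y \<in> W \<Longrightarrow> x \<oplus> y \<in> W" "x \<in> W \<Longrightarrow> c \<bullet> x \<in> W"
    "x \<in> W \<Longrightarrow> x \<in> C" "x \<in> W \<Longrightarrow> \<ominus> x \<in> W"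
  using assms neg_eq_smul unfolding subspace_def by (blast, blast, blast, blast, blast, metis subsetD)

lemma subspace_Int: "subspace V \<Longrightarrow> subspace W \<Longrightarrow> subspace (V \<inter> W)"
  unfolding subspace_def by blast

definition sspan where "sspan bs = {lincomb A cs bs | cs. length cs = length bs}"

lemma sspan_Nil [simp]: "sspan [] = {\<zero>}"
  by (auto simp: sspan_def)

lemma sspan_Cons: "sspan (b # bs) = {c \<bullet> b \<oplus> v | c v. v \<in> sspan bs}"
proof (intro equalityI subsetI)
  fix x assume "x \<in> sspan (b # bs)"
  then obtain cs where "length cs = Suc (length bs)" "x = lincomb A cs (b # bs)"
    by (auto simp: sspan_def)
  then show "x \<in> {c \<bullet> b \<oplus> v | c v. v \<in> sspan bs}"
    by (cases cs) (auto simp: sspan_def)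
next
  fix x assume "x \<in> {c \<bullet> b \<oplus> v | c v. v \<in> sspan bs}"
  then obtain c cs where "length cs = length bs" "x = c \<bullet> b \<oplus> lincomb A cs bs"
    by (auto simp: sspan_def)
  then show "x \<in> sspan (b # bs)"
    unfolding sspan_def by (auto intro!: exI [of _ "c # cs"])
qed

lemma subspace_sspan: "set bs \<subseteq> C \<Longrightarrow> subspace (sspan bs)"
proof (induction bs)
  case Nil
  then show ?case by (auto simp: subspace_def)
next
  case (Cons b bs)
  then have b: "b \<in> C" and S: "subspace (sspan bs)" by auto
  note D = subspaceD [OF S]
  show ?case
    unfolding subspace_def
  proof (intro conjI ballI allI)
    show "sspan (b # bs) \<subseteq> C" using b D by (auto simp: sspan_Cons)
    have "\<zero> = 0 \<bullet> b \<oplus> \<zero>" using b by simp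
    then show "\<zero> \<in> sspan (b # bs)" using D(2) unfolding sspan_Cons by blast
  next
    fix x y assume "x \<in> sspan (b # bs)" "y \<in> sspan (b # bs)"
    then obtain c v d w where *: "x = c \<bullet> b \<oplus> v" "y = d \<bullet> b \<oplus> w" "v \<in> sspan bs" "w \<in> sspan bs"
      by (auto simp: sspan_Cons)
    then have "x \<oplus> y = (c + d) \<bullet> b \<oplus> (v \<oplus> w)"
      using b D(5) by (simp add: ring_simps)
    then show "x \<oplus> y \<in> sspan (b # bs)" using * D(3) unfolding sspan_Cons by blast
  next
    fix c x assume "x \<in> sspan (b # bs)"
    then obtain d w where *: "x = d \<bullet> b \<oplus> w" "w \<in> sspan bs"
      by (auto simp: sspan_Cons)
    then have "c \<bullet> x = (c * d) \<bullet> b \<oplus> c \<bullet> w"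
      using b D(5) by (simp add: smul_distrib smul_smul)
    then show "c \<bullet> x \<in> sspan (b # bs)" using * D(4) unfolding sspan_Cons by blast
  qed
qed

lemma sspan_least: "subspace W \<Longrightarrow> set bs \<subseteq> W \<Longrightarrow> sspan bs \<subseteq> W"
  by (induction bs) (auto simp: sspan_Cons intro!: subspaceD(2-4))

lemma sspan_superset: "set bs \<subseteq> C \<Longrightarrow> set bs \<subseteq> sspan bs"
proof (induction bs)
  case (Cons b bs)
  then have b: "b \<in> C" and S: "subspace (sspan bs)" by (auto intro: subspace_sspan)
  have "b = 1 \<bullet> b \<oplus> \<zero>" using b by simp
  then have "b \<in> sspan (b # bs)" using subspaceD(2) [OF S] unfolding sspan_Cons by blast
  moreover have "v \<in> sspan (b # bs)" if "v \<in> sspan bs" for v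
  proof -
    have "v = 0 \<bullet> b \<oplus> v" using b subspaceD(5) [OF S that] by simp
    then show ?thesis using that unfolding sspan_Cons by blast
  qed
  ultimately show ?case using Cons by auto
qed simp

lemma sspan_mono: "set cs \<subseteq> C \<Longrightarrow> set bs \<subseteq> set cs \<Longrightarrow> sspan bs \<subseteq> sspan cs"
  by (meson sspan_least subspace_sspan sspan_superset order_trans)

text \<open>A subspace of \<open>sspan (b # bs)\<close> not inside \<open>sspan bs\<close> is determined by its trace on
  \<open>sspan bs\<close> and any one of its vectors outside.\<close>

lemma sspan_Cons_pivot:
  assumes b: "b \<in> C" "set bs \<subseteq> C" and W: "subspace W" "W \<subseteq> sspan (b # bs)"
    and w: "w \<in> W" "w \<notin> sspan bs" and x: "x \<in> sspan (b # bs)"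
  obtains c where "x \<oplus> \<ominus> (c \<bullet> w) \<in> sspan bs"
proof -
  have S: "subspace (sspan bs)" using b by (simp add: subspace_sspan)
  obtain d v where w': "w = d \<bullet> b \<oplus> v" "v \<in> sspan bs" using w W by (auto simp: sspan_Cons)
  obtain d' v' where x': "x = d' \<bullet> b \<oplus> v'" "v' \<in> sspan bs" using x by (auto simp: sspan_Cons)
  have "d \<noteq> 0" using w w' b subspaceD(5) [OF S] by auto
  let ?c = "d' / d"
  have vC: "v \<in> C" "v' \<in> C" using w' x' subspaceD(5) [OF S] by auto
  then have "?c \<bullet> w = d' \<bullet> b \<oplus> ?c \<bullet> v"
    using \<open>d \<noteq> 0\<close> b w' by (simp add: smul_distrib smul_smul)
  then have "x \<oplus> \<ominus> (?c \<bullet> w) = v' \<oplus> \<ominus> (?c \<bullet> v)"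
    using x' b vC by (simp add: neg_add add_assoc add_left_comm [of v'])
  then show ?thesis
    using that [of ?c] x' w' subspaceD(3,4,6) [OF S] by metis
qed

text \<open>The spanning vectors are found inside \<open>W\<close> itself: one pivot vector reduces
  all of \<open>W\<close> to its trace on the shorter span. This later turns a whole space of
  structure defects into finitely many.\<close>

lemma subspace_finitely_spanned:
  "set bs \<subseteq> C \<Longrightarrow> subspace W \<Longrightarrow> W \<subseteq> sspan bs \<Longrightarrow> \<exists>ws. set ws \<subseteq> W \<and> W \<subseteq> sspan ws"
proof (induction bs arbitrary: W)
  case Nil
  then show ?case by (intro exI [of _ "[]"]) auto
next
  case (Cons b bs)
  then have b: "b \<in> C" "set bs \<subseteq> C" by auto
  have "subspace (W \<inter> sspan bs)" using Cons b by (intro subspace_Int subspace_sspan)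
  then obtain ws where ws: "set ws \<subseteq> W \<inter> sspan bs" "W \<inter> sspan bs \<subseteq> sspan ws"
    using Cons.IH [of "W \<inter> sspan bs"] b by auto
  show ?case
  proof (cases "W \<subseteq> sspan bs")
    case True
    then show ?thesis using ws by auto
  next
    case False
    then obtain w where w: "w \<in> W" "w \<notin> sspan bs" by auto
    have "x \<in> sspan (w # ws)" if x: "x \<in> W" for x
    proof -
      obtain c where c: "x \<oplus> \<ominus> (c \<bullet> w) \<in> sspan bs"
        using sspan_Cons_pivot [OF b Cons.prems(2,3) w] x Cons.prems by blast
      then have "x \<oplus> \<ominus> (c \<bullet> w) \<in> sspan ws"
        using ws(2) w x subspaceD [OF Cons.prems(2)] by auto
      moreover have "x = c \<bullet> w \<oplus> (x \<oplus> \<ominus> (c \<bullet> w))"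
        using x w subspaceD(5) [OF Cons.prems(2)] by (simp add: add_left_comm [of _ x])
      ultimately show ?thesis unfolding sspan_Cons by blast
    qed
    then show ?thesis using w ws by (intro exI [of _ "w # ws"]) auto
  qed
qed

text \<open>The descending chain condition without a notion of dimension. If no member of
  \<open>\<F>\<close> lies in \<open>sspan bs\<close>, a member with minimal trace on
  \<open>sspan bs\<close> is minimal: a smaller member has the same trace and a vector outside, and
  the pivot recovers everything from these two.\<close>

lemma minimal_subspace:
  "set bs \<subseteq> C \<Longrightarrow> \<F> \<noteq> {} \<Longrightarrow> (\<And>W. W \<in> \<F> \<Longrightarrow> subspace W \<and> W \<subseteq> sspan bs) \<Longrightarrow>
    \<exists>W\<in>\<F>. \<forall>W'\<in>\<F>. W' \<subseteq> W \<longrightarrow> W' = W"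
proof (induction bs arbitrary: \<F>)
  case Nil
  then have "W = {\<zero>}" if "W \<in> \<F>" for W using that subspaceD(2) by fastforce
  then show ?case using Nil by blast
next
  case (Cons b bs)
  then have b: "b \<in> C" "set bs \<subseteq> C" by auto
  show ?case
  proof (cases "\<exists>W\<in>\<F>. W \<subseteq> sspan bs")
    case True
    then have "{W \<in> \<F>. W \<subseteq> sspan bs} \<noteq> {}" by auto
    then have "\<exists>W\<in>{W \<in> \<F>. W \<subseteq> sspan bs}. \<forall>W'\<in>{W \<in> \<F>. W \<subseteq> sspan bs}. W' \<subseteq> W \<longrightarrow> W' = W"
    proof (rule Cons.IH [OF b(2)])
      fix W assume "W \<in> {W \<in> \<F>. W \<subseteq> sspan bs}"
      then show "subspace W \<and> W \<subseteq> sspan bs" using Cons.prems(3) [of W] by simp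
    qed
    then obtain W where "W \<in> \<F>" "W \<subseteq> sspan bs" "\<forall>W'\<in>\<F>. W' \<subseteq> sspan bs \<longrightarrow> W' \<subseteq> W \<longrightarrow> W' = W"
      by simp metis
    then show ?thesis by (intro bexI [of _ W]) simp_all
  next
    case False
    have "\<exists>W\<in>(\<lambda>W. W \<inter> sspan bs) ` \<F>. \<forall>W'\<in>(\<lambda>W. W \<inter> sspan bs) ` \<F>. W' \<subseteq> W \<longrightarrow> W' = W"
    proof (rule Cons.IH)
      show "set bs \<subseteq> C" "(\<lambda>W. W \<inter> sspan bs) ` \<F> \<noteq> {}" using b Cons.prems by auto
      fix W assume "W \<in> (\<lambda>W. W \<inter> sspan bs) ` \<F>"
      then show "subspace W \<and> W \<subseteq> sspan bs"
        using Cons.prems(3) subspace_Int subspace_sspan [OF b(2)] by blast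
    qed
    then obtain W where W: "W \<in> \<F>"
      "\<And>W'. W' \<in> \<F> \<Longrightarrow> W' \<inter> sspan bs \<subseteq> W \<inter> sspan bs \<Longrightarrow> W' \<inter> sspan bs = W \<inter> sspan bs" by auto
    have "W' = W" if W': "W' \<in> \<F>" "W' \<subseteq> W" for W'
    proof (intro equalityI subsetI)
      fix x assume x: "x \<in> W"
      note S' = Cons.prems(3) [OF W'(1), THEN conjunct1]
      note S = Cons.prems(3) [OF W(1), THEN conjunct1]
      obtain w where w: "w \<in> W'" "w \<notin> sspan bs" using False W' by blast
      obtain c where c: "x \<oplus> \<ominus> (c \<bullet> w) \<in> sspan bs"
        using sspan_Cons_pivot [OF b, of W' w x] Cons.prems(3) [OF W'(1)] Cons.prems(3) [OF W(1)] w x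
        by blast
      have "x \<oplus> \<ominus> (c \<bullet> w) \<in> W" using x w W' subspaceD(3,4,6) [OF S] by blast
      then have "x \<oplus> \<ominus> (c \<bullet> w) \<in> W'" using c W(2) [of W'] W' by blast
      then have "x \<oplus> \<ominus> (c \<bullet> w) \<oplus> c \<bullet> w \<in> W'" using w subspaceD(3,4) [OF S'] by blast
      then show "x \<in> W'" using x w subspaceD(5) [OF S] subspaceD(5) [OF S'] by simp
    qed (use W' in auto)
    then show ?thesis using W(1) by (intro bexI [of _ W]) simp_all
  qed
qed

section \<open>Semisimplicity and von Neumann regularity\<close>

definition regular where "regular S \<longleftrightarrow> (\<forall>x\<in>S. \<exists>y\<in>S. x \<odot> y \<odot> x = x)"

definition semiprime where
  "semiprime \<longleftrightarrow> (\<forall>x\<in>C. (\<forall>a\<in>C. x \<odot> a \<odot> x = \<zero>) \<longrightarrow> x = \<zero>)"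

lemma idealD:
  assumes "ideal A I"
  shows "I \<subseteq> C" "subspace I" "x \<in> I \<Longrightarrow> x \<in> C" "r \<in> C \<Longrightarrow> x \<in> I \<Longrightarrow> r \<odot> x \<in> I"
    "r \<in> C \<Longrightarrow> x \<in> I \<Longrightarrow> x \<odot> r \<in> I"
  using assms unfolding ideal_def subspace_def by auto

lemma idealI:
  assumes "subspace I" "\<And>r x. r \<in> C \<Longrightarrow> x \<in> I \<Longrightarrow> r \<odot> x \<in> I" "\<And>r x. r \<in> C \<Longrightarrow> x \<in> I \<Longrightarrow> x \<odot> r \<in> I"
  shows "ideal A I"
  using assms subspaceD [OF assms(1)] unfolding ideal_def by auto

text \<open>Without a unit the ideal generated by \<open>x\<close> is awkward to describe, so two
  annihilators replace it. Both \<open>U\<close> and \<open>V\<close> are ideals containing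
  \<open>x\<close>, and a product of three elements of their intersection has the form v a u, which
  is zero by the definition of \<open>V\<close>.\<close>

lemma semiprimeI:
  assumes nil: "\<And>I. nilpotent_ideal A I \<Longrightarrow> I = {\<zero>}"
  shows semiprime
  unfolding semiprime_def
proof (intro ballI impI)
  fix x assume x: "x \<in> C" and xx: "\<forall>a\<in>C. x \<odot> a \<odot> x = \<zero>"
  define U where "U = {u \<in> C. \<forall>a\<in>C. x \<odot> a \<odot> u = \<zero>}"
  define V where "V = {v \<in> C. \<forall>u\<in>U. \<forall>a\<in>C. v \<odot> a \<odot> u = \<zero>}"
  have UC: "u \<in> C" if "u \<in> U" for u using that by (simp add: U_def)
  have VC: "v \<in> C" if "v \<in> V" for v using that by (simp add: V_def)
  have U: "ideal A U"
  proof (rule idealI)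
    show "subspace U" using x by (auto simp: subspace_def U_def distrib smul_mul)
  next
    fix r u assume r: "r \<in> C" and u: "u \<in> U"
    then have "x \<odot> a \<odot> (r \<odot> u) = x \<odot> (a \<odot> r) \<odot> u" if "a \<in> C" for a
      using x UC that by (simp add: mul_assoc)
    then show "r \<odot> u \<in> U" using r u by (simp add: U_def)
    have "x \<odot> a \<odot> (u \<odot> r) = x \<odot> a \<odot> u \<odot> r" if "a \<in> C" for a
      using x UC that r u by (simp add: mul_assoc)
    then show "u \<odot> r \<in> U" using r u by (simp add: U_def)
  qed
  have V: "ideal A V"
  proof (rule idealI)
    show "subspace V" using UC by (auto simp: subspace_def V_def distrib smul_mul)
  next
    fix r v assume r: "r \<in> C" and v: "v \<in> V"
    have "r \<odot> v \<odot> a \<odot> u = r \<odot> (v \<odot> a \<odot> u)" if "a \<in> C" "u \<in> U" for a u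
      using UC VC that r v by (simp add: mul_assoc)
    then show "r \<odot> v \<in> V" using r v by (simp add: V_def)
    have "v \<odot> r \<odot> a \<odot> u = v \<odot> (r \<odot> a) \<odot> u" if "a \<in> C" "u \<in> U" for a u
      using UC VC that r v by (simp add: mul_assoc)
    then show "v \<odot> r \<in> V" using r v by (simp add: V_def)
  qed
  have UV: "ideal A (U \<inter> V)"
    using idealD [OF U] idealD [OF V] by (intro idealI subspace_Int) auto
  have "lprod A xs = \<zero>" if "length xs = 3" "set xs \<subseteq> U \<inter> V" for xs
  proof -
    from that(1) obtain p q r where xs: "xs = [p, q, r]"
      by (auto simp: numeral_3_eq_3 length_Suc_conv)
    then have "lprod A xs = p \<odot> q \<odot> r" using that UC by (simp add: mul_assoc)
    then show ?thesis using xs that by (simp add: V_def U_def)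
  qed
  then have "nilpotent_ideal A (U \<inter> V)"
    using UV unfolding nilpotent_ideal_def by (intro conjI exI [of _ 3]) auto
  then have "U \<inter> V = {\<zero>}" by (rule nil)
  moreover have "x \<in> U \<inter> V" using x xx by (auto simp: U_def V_def)
  ultimately show "x = \<zero>" by auto
qed

lemma semiprime_left_annihilator:
  "semiprime \<Longrightarrow> x \<in> C \<Longrightarrow> (\<And>a. a \<in> C \<Longrightarrow> x \<odot> a = \<zero>) \<Longrightarrow> x = \<zero>"
  unfolding semiprime_def by auto

section \<open>Right ideals and idempotents in finite-dimensional semiprime algebras\<close>

definition right_ideal where
  "right_ideal T \<longleftrightarrow> subspace T \<and> (\<forall>t\<in>T. \<forall>a\<in>C. t \<odot> a \<in> T)"

lemma right_ideal_image:
  assumes "m \<in> C" "right_ideal T" shows "right_ideal ((\<odot>) m ` T)"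
proof -
  note T = subspaceD [OF conjunct1 [OF assms(2) [unfolded right_ideal_def]]]
  show ?thesis
    unfolding right_ideal_def subspace_def
  proof (intro conjI ballI allI)
    show "(\<odot>) m ` T \<subseteq> C" using assms T by auto
    show "\<zero> \<in> (\<odot>) m ` T" using assms T(2) by (intro image_eqI [of _ _ "\<zero>"]) auto
    fix x assume "x \<in> (\<odot>) m ` T"
    then obtain t where t: "t \<in> T" "x = m \<odot> t" by auto
    show "c \<bullet> x \<in> (\<odot>) m ` T" for c
      using t T assms by (intro image_eqI [of _ _ "c \<bullet> t"]) (auto simp: smul_mul)
    show "x \<odot> a \<in> (\<odot>) m ` T" if "a \<in> C" for a
      using t T that assms unfolding right_ideal_def
      by (intro image_eqI [of _ _ "t \<odot> a"]) (auto simp: mul_assoc)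
    fix y assume "y \<in> (\<odot>) m ` T"
    then obtain u where u: "u \<in> T" "y = m \<odot> u" by auto
    then show "x \<oplus> y \<in> (\<odot>) m ` T"
      using t T assms by (intro image_eqI [of _ _ "t \<oplus> u"]) (auto simp: distrib)
  qed
qed

lemma right_ideal_kernel:
  assumes "m \<in> C" "right_ideal T" shows "right_ideal {t \<in> T. m \<odot> t = \<zero>}"
proof -
  note T = subspaceD [OF conjunct1 [OF assms(2) [unfolded right_ideal_def]]]
  have "m \<odot> (t \<odot> a) = m \<odot> t \<odot> a" if "t \<in> T" "a \<in> C" for t a
    using assms T(5) that by (simp add: mul_assoc)
  then show ?thesis using assms T unfolding right_ideal_def subspace_def
    by (auto simp: distrib smul_mul)
qed

text \<open>Brauer's lemma. On a minimal right ideal \<open>M\<close>, multiplication by a suitable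
  \<open>m\<close> in \<open>M\<close> is bijective, by minimality applied to its image and its
  kernel. Hence \<open>m\<close> = \<open>m e\<close> for some \<open>e\<close> in \<open>M\<close>,
  and \<open>e e - e\<close> lies in the kernel.\<close>

lemma right_ideal_contains_idempotent:
  assumes bs: "set bs \<subseteq> C" "C \<subseteq> sspan bs" and sp: semiprime and T: "right_ideal T" "T \<noteq> {\<zero>}"
  shows "\<exists>e\<in>T. e \<noteq> \<zero> \<and> e \<odot> e = e"
proof -
  have "\<exists>M\<in>{M. right_ideal M \<and> M \<subseteq> T \<and> M \<noteq> {\<zero>}}. \<forall>M'\<in>{M. right_ideal M \<and> M \<subseteq> T \<and> M \<noteq> {\<zero>}}.
      M' \<subseteq> M \<longrightarrow> M' = M"
  proof (rule minimal_subspace [OF bs(1)])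
    show "{M. right_ideal M \<and> M \<subseteq> T \<and> M \<noteq> {\<zero>}} \<noteq> {}" using T by auto
    fix M assume "M \<in> {M. right_ideal M \<and> M \<subseteq> T \<and> M \<noteq> {\<zero>}}"
    then have "subspace M" by (simp add: right_ideal_def)
    then show "subspace M \<and> M \<subseteq> sspan bs" using bs(2) subspaceD(1) by blast
  qed
  then obtain M where M: "right_ideal M" "M \<subseteq> T" "M \<noteq> {\<zero>}"
    and min: "\<And>M'. right_ideal M' \<Longrightarrow> M' \<noteq> {\<zero>} \<Longrightarrow> M' \<subseteq> M \<Longrightarrow> M' = M"
    by simp (metis order_trans)
  note MD = subspaceD [OF conjunct1 [OF M(1) [unfolded right_ideal_def]]]
  obtain x where x: "x \<in> M" "x \<noteq> \<zero>" using M(3) MD(2) by blast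
  then obtain a where a: "a \<in> C" "x \<odot> a \<odot> x \<noteq> \<zero>" using sp MD(5) unfolding semiprime_def by blast
  define m where "m = x \<odot> a"
  have m: "m \<in> M" "m \<in> C" "m \<odot> x \<noteq> \<zero>" using a x M(1) MD(5) unfolding right_ideal_def m_def by auto
  have "(\<odot>) m ` M = M"
  proof (rule min)
    show "right_ideal ((\<odot>) m ` M)" using m M(1) by (intro right_ideal_image)
    show "(\<odot>) m ` M \<noteq> {\<zero>}" using m x by auto
    show "(\<odot>) m ` M \<subseteq> M" using m M(1) MD(5) unfolding right_ideal_def by auto
  qed
  then obtain e where e: "e \<in> M" "m \<odot> e = m" using m by (metis imageE)
  have "e \<in> C" using e MD by auto
  have "{t \<in> M. m \<odot> t = \<zero>} = {\<zero>}"
    using min [OF right_ideal_kernel [OF m(2) M(1)]] m x by blast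
  moreover have "e \<odot> e \<oplus> \<ominus> e \<in> {t \<in> M. m \<odot> t = \<zero>}"
  proof -
    have "m \<odot> (e \<odot> e) = m" using e m \<open>e \<in> C\<close> by (simp flip: mul_assoc)
    moreover have "e \<odot> e \<in> M" using e \<open>e \<in> C\<close> M(1) unfolding right_ideal_def by auto
    ultimately show ?thesis using e m \<open>e \<in> C\<close> MD by (simp add: distrib neg_mul)
  qed
  ultimately have "e \<odot> e \<oplus> \<ominus> e = \<zero>" by blast
  then have "e \<odot> e = e" using \<open>e \<in> C\<close> by (simp add: diff_zero_iff)
  moreover have "e \<noteq> \<zero>" using e m MD(5) [OF x(1)] by auto
  ultimately show ?thesis using e M by blast
qed

text \<open>An idempotent \<open>e\<close> of \<open>T\<close> with minimal kernel on
  \<open>T\<close> has kernel zero, because an idempotent inside the kernel could be joined to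
  \<open>e\<close>. Then t - e t, which \<open>e\<close> kills, is zero for every
  \<open>t\<close>.\<close>

lemma right_ideal_left_unit:
  assumes bs: "set bs \<subseteq> C" "C \<subseteq> sspan bs" and sp: semiprime and T: "right_ideal T"
  shows "\<exists>e\<in>T. \<forall>t\<in>T. e \<odot> t = t"
proof -
  note TD = subspaceD [OF conjunct1 [OF T [unfolded right_ideal_def]]]
  let ?K = "\<lambda>e. {t \<in> T. e \<odot> t = \<zero>}"
  let ?E = "{e \<in> T. e \<odot> e = e}"
  have "\<exists>W\<in>?K ` ?E. \<forall>W'\<in>?K ` ?E. W' \<subseteq> W \<longrightarrow> W' = W"
  proof (rule minimal_subspace [OF bs(1)])
    show "?K ` ?E \<noteq> {}" using TD(2) by auto
    fix W assume "W \<in> ?K ` ?E"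
    then obtain e where "e \<in> T" "W = ?K e" by auto
    then show "subspace W \<and> W \<subseteq> sspan bs"
      using right_ideal_kernel [OF TD(5) T] bs TD(1) unfolding right_ideal_def by blast
  qed
  then obtain e where e: "e \<in> T" "e \<odot> e = e"
    and min: "\<And>g. g \<in> T \<Longrightarrow> g \<odot> g = g \<Longrightarrow> ?K g \<subseteq> ?K e \<Longrightarrow> ?K g = ?K e" by auto
  have eC: "e \<in> C" using e TD by auto
  have "?K e = {\<zero>}"
  proof (rule ccontr)
    assume "?K e \<noteq> {\<zero>}"
    then obtain f where f: "f \<in> T" "e \<odot> f = \<zero>" "f \<noteq> \<zero>" "f \<odot> f = f"
      using right_ideal_contains_idempotent [OF bs sp right_ideal_kernel [OF eC T]] by blast
    have fC: "f \<in> C" using f TD by auto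
    \<comment> \<open>Only \<open>e f\<close> is known to vanish, so the sum of \<open>e\<close> and
      \<open>f\<close> need not be idempotent. Subtracting \<open>f e\<close> restores this and
      gives \<open>e g\<close> = \<open>e\<close> and \<open>f g\<close> = \<open>f\<close>, so the
      kernel of \<open>g\<close> lies in both kernels.\<close>
    define g where "g = e \<oplus> f \<oplus> \<ominus> (f \<odot> e)"
    have gC: "g \<in> C" using eC fC by (simp add: g_def)
    have "f \<odot> e \<in> T" using f eC T unfolding right_ideal_def by simp
    then have gT: "g \<in> T" using e f TD(3,6) unfolding g_def by simp
    have assoc: "e \<odot> (e \<odot> x) = e \<odot> x" "f \<odot> (f \<odot> x) = f \<odot> x" "e \<odot> (f \<odot> x) = \<zero>" if "x \<in> C" for x
      using that e f eC fC by (simp_all flip: mul_assoc)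
    have eg: "e \<odot> g = e" and fg: "f \<odot> g = f"
      using e f eC fC assoc by (simp_all add: g_def distrib neg_mul add_assoc add_left_comm add_comm)
    have "g \<odot> u = e \<odot> u \<oplus> f \<odot> u \<oplus> \<ominus> (f \<odot> (e \<odot> u))" if "u \<in> C" for u
      using eC fC that by (simp add: g_def distrib neg_mul mul_assoc)
    then have "g \<odot> g = g" using eg fg gC by (simp add: g_def)
    moreover have sub: "e \<odot> t = \<zero> \<and> f \<odot> t = \<zero>" if "t \<in> T" "g \<odot> t = \<zero>" for t
    proof -
      have "e \<odot> t = e \<odot> (g \<odot> t)" "f \<odot> t = f \<odot> (g \<odot> t)"
        using mul_assoc [OF eC gC, of t] mul_assoc [OF fC gC, of t] that eg fg TD(5) by simp_all
      then show ?thesis using that eC fC by simp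
    qed
    ultimately have "?K g = ?K e" using min [OF gT] by blast
    then have "g \<odot> f = \<zero>" using f by blast
    then show False using sub [OF f(1)] f by simp
  qed
  moreover have "t \<oplus> \<ominus> (e \<odot> t) \<in> ?K e" if "t \<in> T" for t
  proof -
    have "e \<odot> (e \<odot> t) = e \<odot> t" using that e eC TD(5) by (simp flip: mul_assoc)
    moreover have "e \<odot> t \<in> T" using that e TD(5) T unfolding right_ideal_def by blast
    ultimately show ?thesis using that eC TD by (simp add: distrib neg_mul)
  qed
  ultimately have "\<forall>t\<in>T. e \<odot> t = t" using eC TD(5) diff_zero_iff by (metis (no_types, lifting) closed(3) singletonD)
  then show ?thesis using e by blast
qed

text \<open>Without a unit, \<open>a\<close> is not visibly an element of the right ideal of all
  products \<open>a u\<close>. The left unit \<open>a y\<close> of that ideal therefore fixes only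
  these products, and semiprimeness cancels the right factor \<open>u\<close>.\<close>

lemma semiprime_imp_regular:
  assumes bs: "set bs \<subseteq> C" "C \<subseteq> sspan bs" and sp: semiprime
  shows "regular C"
  unfolding regular_def
proof
  fix a assume a: "a \<in> C"
  have "right_ideal C" by (auto simp: right_ideal_def subspace_def)
  then have "right_ideal ((\<odot>) a ` C)" by (rule right_ideal_image [OF a])
  then obtain y where y: "y \<in> C" "\<And>u. u \<in> C \<Longrightarrow> a \<odot> y \<odot> (a \<odot> u) = a \<odot> u"
    using right_ideal_left_unit [OF bs sp] by blast
  have "a \<odot> y \<odot> a \<oplus> \<ominus> a = \<zero>"
  proof (rule semiprime_left_annihilator [OF sp])
    fix u assume u: "u \<in> C"
    then show "(a \<odot> y \<odot> a \<oplus> \<ominus> a) \<odot> u = \<zero>"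
      using a y(1) y(2) [OF u] by (simp add: distrib neg_mul mul_assoc)
  qed (use a y in simp)
  then show "\<exists>y\<in>C. a \<odot> y \<odot> a = a" using a y by (intro bexI [of _ y]) (simp_all add: diff_zero_iff)
qed

text \<open>Iterating \<open>x\<close> = x y x writes \<open>x\<close> as a product of as many
  elements of \<open>I\<close> as desired, since \<open>x y\<close> lies in
  \<open>I\<close>.\<close>

lemma regular_nilpotent_ideal:
  assumes reg: "regular C" and nil: "nilpotent_ideal A I"
  shows "I = {\<zero>}"
proof -
  have I: "ideal A I" using nil by (simp add: nilpotent_ideal_def)
  obtain n where n: "n > 0" "\<And>xs. length xs = n \<Longrightarrow> set xs \<subseteq> I \<Longrightarrow> lprod A xs = \<zero>"
    using nil unfolding nilpotent_ideal_def by auto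
  have "x = \<zero>" if x: "x \<in> I" for x
  proof -
    have xC: "x \<in> C" using idealD(3) [OF I x] .
    obtain y where y: "y \<in> C" "x \<odot> y \<odot> x = x" using reg xC unfolding regular_def by blast
    have p: "lprod A (replicate k (x \<odot> y) @ [x]) = x" for k
    proof (induction k)
      case (Suc k)
      have "lprod A (u # replicate k v @ [w]) = u \<odot> lprod A (replicate k v @ [w])" for u v w
        by (cases k) auto
      then show ?case using Suc y by simp
    qed simp
    have "lprod A (replicate (n - 1) (x \<odot> y) @ [x]) = \<zero>"
      using n(1) x y idealD(5) [OF I y(1) x] by (intro n(2)) auto
    then show ?thesis using p by simp
  qed
  then show ?thesis using subspaceD(2) [OF idealD(2) [OF I]] by blast
qed

lemma fd_semisimple_iff:
  "fd_semisimple A \<longleftrightarrow> (\<exists>bs. set bs \<subseteq> C \<and> C \<subseteq> sspan bs) \<and> regular C"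
proof -
  have "(\<exists>cs. length cs = length bs \<and> x = lincomb A cs bs) \<longleftrightarrow> x \<in> sspan bs" for x bs
    by (auto simp: sspan_def)
  then have "fin_dim A \<longleftrightarrow> (\<exists>bs. set bs \<subseteq> C \<and> C \<subseteq> sspan bs)"
    by (simp add: fin_dim_def subset_eq [of C])
  moreover have "regular C" if "\<forall>I. nilpotent_ideal A I \<longrightarrow> I = {\<zero>}" "set bs \<subseteq> C" "C \<subseteq> sspan bs" for bs
    using semiprime_imp_regular [OF that(2,3)] semiprimeI that(1) by blast
  ultimately show ?thesis
    unfolding fd_semisimple_def using regular_nilpotent_ideal by blast
qed

section \<open>Central idempotents from nilpotent elements\<close>

text \<open>Multiplication by powers \<open>x\<^sup>i\<close> from the left and from the right; this makes sense for \<open>i = 0\<close>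
  although there is no unit.\<close>

abbreviation lpow where "lpow x i w \<equiv> (((\<odot>) x) ^^ i) w"
abbreviation rpow where "rpow x i w \<equiv> ((\<lambda>u. u \<odot> x) ^^ i) w"

lemma pow_closed [simp]: "x \<in> C \<Longrightarrow> w \<in> C \<Longrightarrow> lpow x i w \<in> C" "x \<in> C \<Longrightarrow> w \<in> C \<Longrightarrow> rpow x i w \<in> C"
  by (induction i) auto

lemma lpow_Suc2: "lpow x (Suc i) w = lpow x i (x \<odot> w)"
  by (simp only: funpow_Suc_right o_apply)

lemma rpow_Suc2: "rpow x (Suc i) w = rpow x i (w \<odot> x)"
  by (simp only: funpow_Suc_right o_apply)

lemma lpow_mul: "x \<in> C \<Longrightarrow> u \<in> C \<Longrightarrow> w \<in> C \<Longrightarrow> lpow x i (u \<odot> w) = lpow x i u \<odot> w"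
  by (induction i) (auto simp: mul_assoc)

lemma rpow_mul: "x \<in> C \<Longrightarrow> u \<in> C \<Longrightarrow> w \<in> C \<Longrightarrow> rpow x i (u \<odot> w) = u \<odot> rpow x i w"
  by (induction i) (auto simp: mul_assoc)

lemma rpow_mul_lpow: "x \<in> C \<Longrightarrow> u \<in> C \<Longrightarrow> w \<in> C \<Longrightarrow> rpow x i u \<odot> w = u \<odot> lpow x i w"
proof (induction i arbitrary: w)
  case (Suc i)
  have "rpow x (Suc i) u \<odot> w = rpow x i u \<odot> (x \<odot> w)" using Suc.prems by (simp add: mul_assoc)
  also have "\<dots> = u \<odot> lpow x i (x \<odot> w)" using Suc by simp
  finally show ?case by (simp only: lpow_Suc2)
qed simp

lemma rpow_add: "x \<in> C \<Longrightarrow> u \<in> C \<Longrightarrow> w \<in> C \<Longrightarrow> rpow x i (u \<oplus> w) = rpow x i u \<oplus> rpow x i w"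
  by (induction i) (auto simp: distrib)

lemma pow_zero [simp]: "x \<in> C \<Longrightarrow> lpow x i \<zero> = \<zero>" "x \<in> C \<Longrightarrow> rpow x i \<zero> = \<zero>"
  by (induction i) auto

lemma lpow_rpow_commute: "x \<in> C \<Longrightarrow> w \<in> C \<Longrightarrow> lpow x i (rpow x j w) = rpow x j (lpow x i w)"
  by (induction j) (auto simp: lpow_mul)

lemma lpow_commuting: "x \<in> C \<Longrightarrow> e \<in> C \<Longrightarrow> x \<odot> e = e \<odot> x \<Longrightarrow> lpow x i e = rpow x i e"
proof (induction i)
  case (Suc i)
  have "lpow x (Suc i) e = x \<odot> rpow x i e" using Suc by simp
  also have "\<dots> = rpow x i (e \<odot> x)" using Suc by (simp flip: rpow_mul)
  finally show ?case by (simp only: rpow_Suc2)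
qed simp

lemma apow_eq_lpow: "apow A x (Suc i) = lpow x i x"
  by (induction i) auto

lemma apow_eq_rpow: "x \<in> C \<Longrightarrow> apow A x (Suc i) = rpow x i x"
  by (simp add: apow_eq_lpow lpow_commuting)

lemma apow_closed [simp]: "x \<in> C \<Longrightarrow> apow A x i \<in> C"
  by (cases i) (simp_all add: apow_eq_lpow del: apow.simps(2,3))

lemma lpow_eq_apow_mul: "x \<in> C \<Longrightarrow> w \<in> C \<Longrightarrow> i > 0 \<Longrightarrow> lpow x i w = apow A x i \<odot> w"
  by (cases i) (simp_all add: apow_eq_lpow funpow_swap1 lpow_mul del: apow.simps(2,3))

lemma lpow_nilpotent:
  assumes "x \<in> C" "w \<in> C" "apow A x (Suc N) = \<zero>" "N < i" shows "lpow x i w = \<zero>"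
proof -
  obtain k where "i = k + Suc N" using assms(4) by (metis Suc_leI le_add_diff_inverse2)
  then have "lpow x i w = lpow x k (lpow x (Suc N) w)" by (simp only: funpow_add o_apply)
  also have "\<dots> = lpow x k (apow A x (Suc N) \<odot> w)" using assms by (subst lpow_eq_apow_mul) auto
  finally show ?thesis using assms by simp
qed

lemma rpow_nilpotent:
  assumes "x \<in> C" "w \<in> C" "apow A x (Suc N) = \<zero>" shows "rpow x (Suc N) w = \<zero>"
proof -
  have "rpow x (Suc N) w = w \<odot> rpow x N x" using assms by (simp only: rpow_Suc2 rpow_mul)
  then show ?thesis using assms by (simp add: apow_eq_rpow del: apow.simps)
qed

section \<open>Finite sums and telescoping\<close>

primrec psum :: "(nat \<Rightarrow> 'a) \<Rightarrow> nat \<Rightarrow> 'a" where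
  "psum f 0 = \<zero>"
| "psum f (Suc n) = psum f n \<oplus> f n"

lemma psum_closed [simp]: "subspace W \<Longrightarrow> (\<And>i. i < n \<Longrightarrow> f i \<in> W) \<Longrightarrow> psum f n \<in> W"
  by (induction n) (auto intro: subspaceD)

lemma subspace_C: "subspace C"
  by (auto simp: subspace_def)

lemma psum_closed_C [simp]: "(\<And>i. f i \<in> C) \<Longrightarrow> psum f n \<in> C"
  by (simp add: subspace_C)

lemma psum_mul:
  assumes "u \<in> C" "\<And>i. f i \<in> C"
  shows "u \<odot> psum f n = psum (\<lambda>i. u \<odot> f i) n" "psum f n \<odot> u = psum (\<lambda>i. f i \<odot> u) n"
  using assms by (induction n) (auto simp: distrib)

lemma psum_cong: "(\<And>i. i < n \<Longrightarrow> f i = g i) \<Longrightarrow> psum f n = psum g n"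
  by (induction n) auto

lemma psum_last: "(\<And>i. f i \<in> C) \<Longrightarrow> (\<And>i. i < n \<Longrightarrow> f i = \<zero>) \<Longrightarrow> psum f (Suc n) = f n"
proof -
  assume f: "\<And>i. f i \<in> C" and z: "\<And>i. i < n \<Longrightarrow> f i = \<zero>"
  have "psum f n = psum (\<lambda>i. \<zero>) n" using z by (intro psum_cong)
  moreover have "psum (\<lambda>i. \<zero>) n = \<zero>" by (induction n) auto
  ultimately show ?thesis using f by simp
qed

lemma psum_shift: "(\<And>i. f i \<in> C) \<Longrightarrow> f 0 \<oplus> psum (\<lambda>i. f (Suc i)) n = psum f n \<oplus> f n"
proof (induction n)
  case (Suc n)
  have "f 0 \<oplus> psum (\<lambda>i. f (Suc i)) (Suc n) = f 0 \<oplus> psum (\<lambda>i. f (Suc i)) n \<oplus> f (Suc n)"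
    using Suc.prems by (simp add: add_assoc)
  then show ?case using Suc by simp
qed simp

text \<open>For w = X + c the hypotheses give w w = w X, so w^(k+1) = w X^k. Hence w^(N+2) vanishes
  automatically, and the index bound lowers the exponent by one; what remains of w X^N is c X^N.
  This is how the bound acts against a noncentral idempotent.\<close>

lemma index_shift_zero:
  assumes C: "X \<in> C" "c \<in> C" and Xc: "X \<odot> c = \<zero>" "c \<odot> c = \<zero>" and X: "apow A X (Suc N) = \<zero>"
    and index: "nilpotent_elt A (X \<oplus> c) \<Longrightarrow> apow A (X \<oplus> c) (Suc N) = \<zero>"
  shows "rpow X N c = \<zero>"
proof -
  let ?w = "X \<oplus> c"
  have ww: "?w \<odot> ?w = ?w \<odot> X" using C Xc by (simp add: distrib)
  have pow: "apow A ?w (Suc k) = rpow X k ?w" for k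
  proof (induction k)
    case (Suc k)
    have "apow A ?w (Suc (Suc k)) = ?w \<odot> rpow X k ?w" using Suc by simp
    also have "\<dots> = rpow X k (?w \<odot> X)" using C ww by (simp flip: rpow_mul)
    finally show ?case by (simp only: rpow_Suc2)
  qed simp
  have "apow A ?w (Suc (Suc N)) = \<zero>"
    using rpow_nilpotent [OF C(1) _ X] C by (simp only: pow closed)
  then have "nilpotent_elt A ?w" unfolding nilpotent_elt_def by blast
  then have "rpow X N ?w = \<zero>" using index pow by simp
  then show ?thesis using C X by (simp add: rpow_add apow_eq_rpow del: apow.simps)
qed

definition central_idem where
  "central_idem e \<longleftrightarrow> e \<in> C \<and> e \<odot> e = e \<and> (\<forall>y\<in>C. e \<odot> y = y \<odot> e)"

text \<open>The elements \<open>x\<^sup>i z x\<^bsup>N-j\<^esup>\<close> form a system of \<open>N + 1\<close> by \<open>N + 1\<close> matrix units, whose sum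
  \<open>e\<close> of diagonal units is central: otherwise some \<open>e x + (1 - e) y z\<close> would be nilpotent of
  index \<open>N + 2\<close>.\<close>

lemma matrix_units_central:
  assumes J: "ideal A J" and reg: "regular J"
    and index: "\<And>u. u \<in> J \<Longrightarrow> nilpotent_elt A u \<Longrightarrow> apow A u (Suc N) = \<zero>"
    and x: "x \<in> J" "apow A x (Suc N) = \<zero>" and z: "z \<in> J"
    and zz: "\<And>j. j < N \<Longrightarrow> z \<odot> lpow x j z = \<zero>" "z \<odot> lpow x N z = z"
  obtains e where "e \<in> J" "central_idem e" "e \<odot> z = z"
proof -
  note JD = idealD [OF J]
  have xC: "x \<in> C" and zC: "z \<in> C" using x z JD(3) by auto
  have powJ: "lpow x i u \<in> J" "rpow x i u \<in> J" if "u \<in> J" for i u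
    using that xC JD(4,5) by (induction i) auto
  define t where "t i = lpow x i (rpow x (N - i) z)" for i
  have tC [simp]: "t i \<in> C" for i using xC zC by (simp add: t_def)
  define e where "e = psum t (Suc N)"
  have eJ: "e \<in> J" unfolding e_def using powJ z JD(2) by (intro psum_closed) (auto simp: t_def)
  then have eC: "e \<in> C" using JD(3) by auto
  \<comment> \<open>With s i = x^i z x^(N+1-i), the summands \<open>x t i\<close> and
    \<open>t i x\<close> are s (i+1) and s i. The two sums differ only in s 0 and s (N+1), which
    contain x^(N+1).\<close>
  have xe: "x \<odot> e = e \<odot> x"
  proof -
    define s where "s i = lpow x i (rpow x (Suc N - i) z)" for i
    have s: "s i \<in> C" for i using xC zC by (simp add: s_def)
    have "x \<odot> e = psum (\<lambda>i. s (Suc i)) (Suc N)"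
      unfolding e_def using xC by (simp only: psum_mul tC) (simp add: s_def t_def)
    moreover have "e \<odot> x = psum s (Suc N)"
      unfolding e_def using xC zC
      by (simp only: psum_mul tC) (intro psum_cong, simp add: s_def t_def Suc_diff_le flip: lpow_mul)
    moreover have "s 0 = \<zero>" using rpow_nilpotent [OF xC zC x(2)] by (simp only: s_def diff_zero funpow_0)
    moreover have "s (Suc N) = \<zero>"
      unfolding s_def by (rule lpow_nilpotent [OF xC _ x(2)]) (use xC zC in auto)
    moreover have "psum s (Suc N) \<in> C" "psum (\<lambda>i. s (Suc i)) (Suc N) \<in> C"
      using s by (simp_all only: psum_closed_C)
    ultimately show ?thesis using psum_shift [of s "Suc N"] s by (simp del: psum.simps)
  qed
  \<comment> \<open>The factor z x^i z kills every summand except the last.\<close>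
  have ze: "z \<odot> e = z"
  proof -
    have "z \<odot> t i = rpow x (N - i) (z \<odot> lpow x i z)" for i
      using xC zC by (simp add: t_def lpow_rpow_commute rpow_mul)
    then have "psum (\<lambda>i. z \<odot> t i) (Suc N) = z \<odot> t N"
      using zC zz xC by (intro psum_last) auto
    then show ?thesis using zC zz unfolding e_def by (simp only: psum_mul tC) (simp add: t_def)
  qed
  \<comment> \<open>Here z x^(N-i) z kills every summand except the first, so the sum is split at
    the front by \<open>psum_shift\<close>.\<close>
  have ez: "e \<odot> z = z"
  proof -
    have "t i \<odot> z = lpow x i (z \<odot> lpow x (N - i) z)" for i
      using xC zC by (simp add: t_def rpow_mul_lpow flip: lpow_mul)
    then have *: "t 0 \<odot> z = z" "\<And>i. i < N \<Longrightarrow> t (Suc i) \<odot> z = \<zero>" using zz xC by auto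
    have "e \<odot> z = psum (\<lambda>i. t i \<odot> z) N \<oplus> t N \<odot> z"
      unfolding e_def using zC by (simp only: psum_mul tC) simp
    also have "\<dots> = t 0 \<odot> z \<oplus> psum (\<lambda>i. t (Suc i) \<odot> z) N"
      using zC by (intro psum_shift [symmetric]) auto
    also have "psum (\<lambda>i. t (Suc i) \<odot> z) N = psum (\<lambda>i. \<zero>) N" using * by (intro psum_cong)
    also have "\<dots> = \<zero>" by (induction N) auto
    finally show ?thesis using * zC by simp
  qed
  have ee: "e \<odot> e = e"
  proof -
    have "t i \<odot> e = t i" for i
    proof -
      have "t i \<odot> e = lpow x i (z \<odot> lpow x (N - i) e)"
        using xC zC eC by (simp add: t_def rpow_mul_lpow flip: lpow_mul)
      also have "z \<odot> lpow x (N - i) e = rpow x (N - i) z"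
        using xC zC eC xe ze by (simp add: lpow_commuting flip: rpow_mul)
      finally show ?thesis by (simp add: t_def)
    qed
    then show ?thesis using eC by (simp add: psum_mul(2) e_def del: psum.simps)
  qed
  \<comment> \<open>The element c = (1 - e) y z used below need not be killed by \<open>x\<close>
    from the left. It is killed by \<open>e x\<close>, which is still nilpotent because
    \<open>x\<close> and \<open>e\<close> commute.\<close>
  define X where "X = e \<odot> x"
  have XJ: "X \<in> J" and XC: "X \<in> C" using x JD eC xC by (auto simp: X_def)
  have "lpow X k (e \<odot> x) = e \<odot> lpow x k x" for k
  proof (induction k)
    case (Suc k)
    let ?v = "lpow x k x"
    have v: "?v \<in> C" using xC by simp
    have "lpow X (Suc k) (e \<odot> x) = e \<odot> x \<odot> (e \<odot> ?v)" using Suc by (simp add: X_def)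
    also have "\<dots> = e \<odot> (x \<odot> e) \<odot> ?v" using eC xC v by (simp add: mul_assoc)
    also have "\<dots> = e \<odot> e \<odot> (x \<odot> ?v)" unfolding xe using eC xC v by (simp add: mul_assoc)
    finally show ?case using ee by simp
  qed simp
  then have X: "apow A X (Suc N) = \<zero>" using x(2) eC by (simp add: apow_eq_lpow X_def del: apow.simps)
  define r where "r = rpow x N z"
  have rC: "r \<in> C" using xC zC by (simp add: r_def)
  \<comment> \<open>Half of centrality, first on r = z x^N. From \<open>e c\<close> = 0 come
    \<open>X c\<close> = 0 and \<open>c c\<close> = 0; from \<open>c e\<close> = \<open>c\<close>
    comes c X^N = c x^N = (1 - e) y r. The index bound makes this element zero.\<close>
  have r: "y \<odot> r = e \<odot> (y \<odot> r)" if y: "y \<in> C" for y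
  proof -
    define c where "c = (y \<oplus> \<ominus> (e \<odot> y)) \<odot> z"
    have yC: "y \<oplus> \<ominus> (e \<odot> y) \<in> C" using y eC by simp
    have cJ: "c \<in> J" and cC: "c \<in> C" using JD(4) [OF yC z] JD(3) by (auto simp: c_def)
    have e0: "e \<odot> (y \<oplus> \<ominus> (e \<odot> y)) = \<zero>"
      using y eC ee by (simp add: distrib neg_mul flip: mul_assoc)
    have "e \<odot> c = \<zero>" using e0 yC zC eC by (simp add: c_def flip: mul_assoc)
    then have "X \<odot> c = \<zero>" using xC eC cC by (simp add: X_def mul_assoc flip: xe)
    moreover have "z \<odot> c = z \<odot> e \<odot> c" using ze by simp
    then have "z \<odot> c = \<zero>" using \<open>e \<odot> c = \<zero>\<close> zC eC cC by (simp add: mul_assoc)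
    then have "c \<odot> c = \<zero>" using mul_assoc [OF yC zC cC] yC by (simp add: c_def)
    ultimately have "rpow X N c = \<zero>"
      using index subspaceD(3) [OF JD(2) XJ cJ] X by (intro index_shift_zero [OF XC cC]) auto
    moreover have "rpow X k c = rpow x k c" for k
    proof (induction k)
      case (Suc k)
      have "rpow x k c \<odot> e = rpow x k (c \<odot> e)"
        using xC cC eC xe by (simp add: rpow_mul_lpow lpow_commuting flip: rpow_mul)
      also have "c \<odot> e = c" using yC zC eC ze by (simp add: c_def mul_assoc)
      finally show ?case using Suc xC cC eC by (simp add: X_def flip: mul_assoc)
    qed simp
    ultimately have "rpow x N c = \<zero>" by simp
    then have "(y \<oplus> \<ominus> (e \<odot> y)) \<odot> r = \<zero>" using yC zC xC by (simp add: c_def r_def rpow_mul)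
    then show ?thesis using y eC rC by (simp add: distrib neg_mul mul_assoc diff_zero_iff)
  qed
  \<comment> \<open>Every diagonal unit factors through \<open>r\<close>, since z = r z gives t i =
    x^i r z x^(N-i). The previous claim is applied with y x^i in place of \<open>y\<close>.\<close>
  have ye: "y \<odot> e = e \<odot> (y \<odot> e)" if y: "y \<in> C" for y
  proof -
    have "y \<odot> t i = e \<odot> (y \<odot> t i)" for i
    proof -
      have "z = r \<odot> z" using zz xC zC by (simp add: r_def rpow_mul_lpow)
      then have "t i = lpow x i (rpow x (N - i) (r \<odot> z))" by (simp add: t_def)
      also have "\<dots> = lpow x i r \<odot> rpow x (N - i) z" using xC zC rC by (simp add: rpow_mul lpow_mul)
      finally have t: "y \<odot> t i = rpow x i y \<odot> r \<odot> rpow x (N - i) z"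
        using xC zC rC y by (simp add: rpow_mul_lpow mul_assoc)
      also have "\<dots> = e \<odot> (rpow x i y \<odot> r) \<odot> rpow x (N - i) z"
        using r [of "rpow x i y"] xC y by simp
      finally show ?thesis unfolding t using xC zC rC y eC by (simp add: mul_assoc)
    qed
    then have "psum (\<lambda>i. y \<odot> t i) (Suc N) = psum (\<lambda>i. e \<odot> (y \<odot> t i)) (Suc N)" by metis
    moreover have "psum (\<lambda>i. y \<odot> t i) (Suc N) = y \<odot> e"
      using y unfolding e_def by (simp only: psum_mul tC)
    moreover have "psum (\<lambda>i. e \<odot> (y \<odot> t i)) (Suc N) = e \<odot> psum (\<lambda>i. y \<odot> t i) (Suc N)"
      using y eC by (intro psum_mul(1) [symmetric]) auto
    ultimately show ?thesis by simp
  qed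
  have "e \<odot> y = y \<odot> e" if y: "y \<in> C" for y
  proof -
    \<comment> \<open>The other half comes from regularity and not from the index. With c = e y (1 -
      e), one has c = c s c = c (s e) c; the half already proved turns \<open>s e\<close> into e s
      e, and \<open>c e\<close> = 0.\<close>
    define c where "c = e \<odot> y \<oplus> \<ominus> (e \<odot> y \<odot> e)"
    have cC: "c \<in> C" using y eC by (simp add: c_def)
    have cJ: "c \<in> J" using eJ y eC JD(5) subspaceD(3,6) [OF JD(2)] by (simp add: c_def)
    obtain s where s: "s \<in> J" "c \<odot> s \<odot> c = c" using reg cJ unfolding regular_def by blast
    have sC: "s \<in> C" using s JD by auto
    have "e \<odot> c = c" using y eC ee by (simp add: c_def distrib neg_mul flip: mul_assoc)
    have "c \<odot> e = \<zero>" using y eC ee by (simp add: c_def distrib neg_mul mul_assoc)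
    have "c = c \<odot> (s \<odot> e) \<odot> c" using s \<open>e \<odot> c = c\<close> sC cC eC by (simp add: mul_assoc)
    also have "s \<odot> e = e \<odot> (s \<odot> e)" using ye sC by blast
    also have "c \<odot> (e \<odot> (s \<odot> e)) = \<zero>" using \<open>c \<odot> e = \<zero>\<close> sC cC eC by (simp flip: mul_assoc)
    finally have "c = \<zero>" using cC by simp
    then have "e \<odot> y = e \<odot> y \<odot> e" using y eC by (simp add: c_def diff_zero_iff)
    then show ?thesis using ye [OF y] y eC by (simp add: mul_assoc)
  qed
  then show ?thesis using that eJ eC ee ez unfolding central_idem_def by blast
qed

text \<open>Starting from any quasi-inverse of \<open>x\<^sup>N\<close>, the products \<open>y x\<^bsup>N-m\<^esup> y\<close> are cleared one
  after the other by \<open>y := y - (y x\<^bsup>N-m\<^esup> y x\<^sup>N) y x\<^sup>m\<close>.\<close>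

lemma adapted_quasi_inverse:
  assumes J: "ideal A J" and reg: "regular J" and N: "N > 0"
    and x: "x \<in> J" "apow A x (Suc N) = \<zero>" and a: "a = apow A x N" "a \<in> J"
  shows "k \<le> N \<Longrightarrow> \<exists>y\<in>J. a \<odot> y \<odot> a = a \<and> y \<odot> a \<odot> y = y \<and>
    (\<forall>m. 1 \<le> m \<and> m \<le> k \<longrightarrow> y \<odot> lpow x (N - m) (y \<odot> a) = \<zero>)"
proof (induction k)
  case 0
  obtain y where y: "y \<in> J" "a \<odot> y \<odot> a = a" using reg a unfolding regular_def by blast
  have C: "a \<in> C" "y \<in> C" using a y idealD(3) [OF J] by auto
  have *: "a \<odot> (y \<odot> (a \<odot> u)) = a \<odot> u" if "u \<in> C" for u
    using y C that by (metis mul_assoc closed(3))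
  have **: "a \<odot> (y \<odot> a) = a" using y C by (simp add: mul_assoc)
  \<comment> \<open>The element y a y is again a quasi-inverse and moreover satisfies the second
    identity, by which the idempotent \<open>y a\<close> fixes \<open>y\<close> from the
    left.\<close>
  show ?case
  proof (intro bexI conjI)
    show "y \<odot> a \<odot> y \<in> J" using y C idealD(4) [OF J] by auto
    show "a \<odot> (y \<odot> a \<odot> y) \<odot> a = a" using C * ** by (simp add: mul_assoc)
    show "y \<odot> a \<odot> y \<odot> a \<odot> (y \<odot> a \<odot> y) = y \<odot> a \<odot> y" using C * ** by (simp add: mul_assoc)
  qed auto
next
  case (Suc k)
  then obtain y where y: "y \<in> J" "a \<odot> y \<odot> a = a" "y \<odot> a \<odot> y = y"
    and clear: "\<And>m. 1 \<le> m \<Longrightarrow> m \<le> k \<Longrightarrow> y \<odot> lpow x (N - m) (y \<odot> a) = \<zero>" by auto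
  note JD = idealD [OF J]
  have C: "a \<in> C" "y \<in> C" "x \<in> C" using a y x JD(3) by auto
  define p where "p = y \<odot> a"
  have pC: "p \<in> C" using C by (simp add: p_def)
  have pp: "p \<odot> p = p" and py: "p \<odot> y = y" and ap: "a \<odot> p = a"
    using y C by (simp_all add: p_def flip: mul_assoc)
  \<comment> \<open>The next product to be cleared. It is fixed by the idempotent \<open>p\<close> =
    \<open>y a\<close> on both sides, which lets the correction cancel it exactly.\<close>
  define c where "c = y \<odot> lpow x (N - Suc k) p"
  have cC: "c \<in> C" using C pC by (simp add: c_def)
  have pc: "p \<odot> c = c" using C pC py by (simp add: c_def flip: mul_assoc)
  have cp: "c \<odot> p = c" using C pC pp by (simp add: c_def mul_assoc flip: lpow_mul)
  define z where "z = y \<oplus> \<ominus> (c \<odot> rpow x (Suc k) y)"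
  have zC: "z \<in> C" using C cC by (simp add: z_def)
  have cy: "c \<odot> rpow x (Suc k) y = c \<odot> y \<odot> rpow x k x"
    using C cC by (simp add: rpow_Suc2 rpow_mul mul_assoc del: funpow.simps)
  have zJ: "z \<in> J"
    unfolding z_def cy using y C cC JD(4,5) subspaceD(3,6) [OF JD(2)] by simp
  have zw: "z \<odot> w = y \<odot> w \<oplus> \<ominus> (c \<odot> (y \<odot> lpow x (Suc k) w))" if "w \<in> C" for w
    using that C cC by (simp add: z_def distrib neg_mul mul_assoc rpow_mul_lpow del: funpow.simps)
  \<comment> \<open>The total exponent N + k + 1 exceeds N, so the correction vanishes on
    \<open>a\<close> and \<open>z a\<close> = \<open>y a\<close> = \<open>p\<close>. The right end
    of all the products thus stays the same from round to round.\<close>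
  have "lpow x (Suc k) a = \<zero>"
  proof -
    have "lpow x (Suc k) a = lpow x (Suc k) (lpow x (N - 1) x)"
      using N a by (cases N) (simp_all add: apow_eq_lpow del: apow.simps(2,3))
    also have "\<dots> = lpow x (k + N) x" using N by (simp only: funpow_add [THEN fun_cong, unfolded o_apply, symmetric]) simp
    also have "\<dots> = lpow x k (lpow x N x)" by (simp add: funpow_add)
    finally show ?thesis using x C by (simp add: apow_eq_lpow del: apow.simps)
  qed
  then have za: "z \<odot> a = p" using zw C cC by (simp add: p_def)
  have pz: "p \<odot> z = z"
    using C cC pC pc py by (simp add: z_def distrib neg_mul flip: mul_assoc del: funpow.simps)
  show ?case
  proof (intro bexI conjI allI impI)
    show "z \<in> J" by (rule zJ)
    show "a \<odot> z \<odot> a = a" using za ap C zC by (simp add: mul_assoc)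
    show "z \<odot> a \<odot> z = z" using za pz by simp
    fix m assume m: "1 \<le> m \<and> m \<le> Suc k"
    let ?w = "lpow x (N - m) p"
    have wC: "?w \<in> C" using C pC by simp
    have shift: "lpow x (Suc k) ?w = lpow x (Suc k + (N - m)) p"
      by (simp only: funpow_add o_apply)
    \<comment> \<open>In the correction term \<open>x\<close> has exponent N + (k + 1 - m). For m =
      k + 1 this is N and the term equals c p = c, the defect itself. For smaller m the power
      vanishes, so products cleared earlier remain zero.\<close>
    have "z \<odot> ?w = \<zero>"
    proof (cases "m = Suc k")
      case True
      have "lpow x (Suc k) ?w = a \<odot> p"
        unfolding shift using True Suc.prems N a C pC by (simp add: lpow_eq_apow_mul del: funpow.simps)
      then have "z \<odot> ?w = c \<oplus> \<ominus> (c \<odot> (y \<odot> a))"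
        using zw [OF wC] True ap by (simp add: c_def del: funpow.simps)
      then show ?thesis using cp cC by (simp add: p_def)
    next
      case False
      then have "lpow x (Suc k) ?w = \<zero>"
        unfolding shift using m Suc.prems C pC by (intro lpow_nilpotent [OF _ _ x(2)]) auto
      moreover have "y \<odot> ?w = \<zero>" using clear [of m] m False by (simp add: p_def)
      ultimately show ?thesis using zw [OF wC] C cC by (simp del: funpow.simps)
    qed
    then show "z \<odot> lpow x (N - m) (z \<odot> a) = \<zero>" by (simp add: za)
  qed
qed

text \<open>For the adapted quasi-inverse \<open>z\<close> of a = x^N, inserting z = z a z turns the
  cleared products into the matrix unit relations z x^j z = 0 for j < N and z x^N z = z. The central
  \<open>e\<close> then fixes a = a z a, because it may be moved next to \<open>z\<close>.\<close>

lemma central_cover_power: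
  assumes J: "ideal A J" and reg: "regular J" and N: "N > 0"
    and index: "\<And>u. u \<in> J \<Longrightarrow> nilpotent_elt A u \<Longrightarrow> apow A u (Suc N) = \<zero>"
    and x: "x \<in> J" "apow A x (Suc N) = \<zero>" and a: "apow A x N \<in> J"
  shows "\<exists>e\<in>J. central_idem e \<and> e \<odot> apow A x N = apow A x N"
proof -
  define a where "a = apow A x N"
  obtain z where z: "z \<in> J" "a \<odot> z \<odot> a = a" "z \<odot> a \<odot> z = z"
    and clear: "\<And>m. 1 \<le> m \<Longrightarrow> m \<le> N \<Longrightarrow> z \<odot> lpow x (N - m) (z \<odot> a) = \<zero>"
    using adapted_quasi_inverse [OF J reg N x a_def _ order_refl] a unfolding a_def by auto
  have C: "x \<in> C" "z \<in> C" "a \<in> C" using x z a idealD(3) [OF J] by (auto simp: a_def)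
  have 1: "z \<odot> lpow x j z = \<zero>" if "j < N" for j
  proof -
    have "z \<odot> lpow x j z = z \<odot> lpow x j (z \<odot> a \<odot> z)" using z by simp
    also have "\<dots> = z \<odot> lpow x (N - (N - j)) (z \<odot> a) \<odot> z"
      using C that by (simp add: lpow_mul mul_assoc)
    finally show ?thesis using clear [of "N - j"] that C by simp
  qed
  have 2: "z \<odot> lpow x N z = z" using C N z by (simp add: lpow_eq_apow_mul a_def mul_assoc)
  obtain e where e: "e \<in> J" "central_idem e" "e \<odot> z = z"
    using matrix_units_central [OF J reg index x z(1) 1 2] by blast
  have eC: "e \<in> C" and ea: "e \<odot> a = a \<odot> e" using e C unfolding central_idem_def by auto
  have "e \<odot> a = e \<odot> a \<odot> (z \<odot> a)" using z C eC by (simp add: mul_assoc)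
  also have "\<dots> = a \<odot> (e \<odot> z) \<odot> a" unfolding ea using C eC by (simp add: mul_assoc)
  also have "\<dots> = a" using e z by simp
  finally show ?thesis using e unfolding a_def by blast
qed

text \<open>The one by one case of the matrix units: \<open>x\<close> is zero, N = 0, and the
  relation z x^0 z = z says only that \<open>z\<close> = \<open>a y\<close> is idempotent. It is
  separate because \<open>apow A x 0\<close> is zero and not a unit, so the version for powers would
  say nothing here.\<close>

lemma central_cover_reduced:
  assumes J: "ideal A J" and reg: "regular J"
    and index: "\<And>u. u \<in> J \<Longrightarrow> nilpotent_elt A u \<Longrightarrow> u = \<zero>" and a: "a \<in> J"
  shows "\<exists>e\<in>J. central_idem e \<and> e \<odot> a = a"
proof -
  obtain y where y: "y \<in> J" "a \<odot> y \<odot> a = a" using reg a unfolding regular_def by blast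
  have C: "a \<in> C" "y \<in> C" using a y idealD(3) [OF J] by auto
  have ay: "a \<odot> y \<in> J" "a \<odot> y \<odot> (a \<odot> y) = a \<odot> y"
    using y C a idealD(5) [OF J] by (simp_all flip: mul_assoc)
  obtain e where e: "e \<in> J" "central_idem e" "e \<odot> (a \<odot> y) = a \<odot> y"
    using matrix_units_central [OF J reg, of 0 \<zero> "a \<odot> y"] index ay subspaceD(2) [OF idealD(2) [OF J]] by auto
  have "e \<in> C" using e unfolding central_idem_def by blast
  then have "e \<odot> (a \<odot> y \<odot> a) = e \<odot> (a \<odot> y) \<odot> a" using C by (simp add: mul_assoc)
  then show ?thesis using e y by auto
qed

text \<open>The ideal generated by those idempotents of \<open>J\<close> that are central in the
  whole algebra. One idempotent per element suffices, since two of them are dominated by e + f - e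
  f.\<close>

definition central_part where "central_part J = {x \<in> J. \<exists>e\<in>J. central_idem e \<and> e \<odot> x = x}"

lemma central_idem_join:
  assumes J: "ideal A J" and e: "e \<in> J" "central_idem e" and f: "f \<in> J" "central_idem f"
  obtains g where "g \<in> J" "central_idem g"
    "\<And>x. x \<in> C \<Longrightarrow> e \<odot> x = x \<Longrightarrow> g \<odot> x = x" "\<And>x. x \<in> C \<Longrightarrow> f \<odot> x = x \<Longrightarrow> g \<odot> x = x"
proof -
  have C: "e \<in> C" "f \<in> C" using e f unfolding central_idem_def by auto
  have ee: "e \<odot> e = e" and ff: "f \<odot> f = f" using e f unfolding central_idem_def by auto
  have com: "e \<odot> y = y \<odot> e" "f \<odot> y = y \<odot> f" if "y \<in> C" for y
    using that e f unfolding central_idem_def by auto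
  define g where "g = e \<oplus> f \<oplus> \<ominus> (e \<odot> f)"
  have gC: "g \<in> C" using C by (simp add: g_def)
  have ex: "g \<odot> x = x" if "x \<in> C" "e \<odot> x = x" for x
  proof -
    have "e \<odot> (f \<odot> x) = f \<odot> (e \<odot> x)" using com(1) [of f] C that by (metis mul_assoc)
    then show ?thesis using that C by (simp add: g_def distrib neg_mul mul_assoc add_assoc)
  qed
  have fx: "g \<odot> x = x" if "x \<in> C" "f \<odot> x = x" for x
    using that C by (simp add: g_def distrib neg_mul mul_assoc add_assoc add_left_comm [of _ x])
  have "g \<odot> y = y \<odot> g" if y: "y \<in> C" for y
  proof -
    have "e \<odot> (y \<odot> f) = y \<odot> (e \<odot> f)" using com(1) [OF y] y C by (metis mul_assoc)
    then show ?thesis using com [OF y] y C by (simp add: g_def distrib neg_mul mul_assoc)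
  qed
  moreover have "g \<odot> g = g"
  proof -
    have "u \<odot> g = u \<odot> e \<oplus> u \<odot> f \<oplus> \<ominus> (u \<odot> e \<odot> f)" if "u \<in> C" for u
      using C that by (simp add: g_def distrib neg_mul mul_assoc)
    then show ?thesis using ex [OF C(1) ee] fx [OF C(2) ff] gC by (simp add: g_def)
  qed
  ultimately have "central_idem g" using gC unfolding central_idem_def by blast
  moreover have "g \<in> J"
    using e f C idealD(4) [OF J] subspaceD(3,6) [OF idealD(2) [OF J]] by (simp add: g_def)
  ultimately show ?thesis using that ex fx by blast
qed

lemma ideal_central_part:
  assumes J: "ideal A J"
  shows "ideal A (central_part J)"
proof -
  note JD = idealD [OF J] subspaceD [OF idealD(2) [OF J]]
  have comm: "e \<odot> y = y \<odot> e" and eC: "e \<in> C" if "central_idem e" "y \<in> C" for e y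
    using that unfolding central_idem_def by auto
  show ?thesis
  proof (rule idealI)
    show "subspace (central_part J)"
      unfolding subspace_def
    proof (intro conjI ballI allI)
      show "central_part J \<subseteq> C" using JD by (auto simp: central_part_def)
      show "\<zero> \<in> central_part J"
        using JD(7) unfolding central_part_def central_idem_def by (auto intro!: bexI [of _ \<zero>])
      fix x assume "x \<in> central_part J"
      then obtain e where x: "x \<in> J" "x \<in> C" and e: "e \<in> J" "central_idem e" "e \<odot> x = x" "e \<in> C"
        using JD(3) by (auto simp: central_part_def)
      show "c \<bullet> x \<in> central_part J" for c
        using x e JD(9) unfolding central_part_def by (auto intro!: bexI [of _ e] simp: smul_mul)
      fix y assume "y \<in> central_part J"
      then obtain f where y: "y \<in> J" "y \<in> C" and f: "f \<in> J" "central_idem f" "f \<odot> y = y"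
        using JD(3) by (auto simp: central_part_def)
      obtain g where g: "g \<in> J" "central_idem g" "g \<odot> x = x" "g \<odot> y = y"
        using central_idem_join [OF J e(1,2) f(1,2)] x y e f by metis
      then show "x \<oplus> y \<in> central_part J"
        using x y JD(8) JD(3) [OF g(1)] unfolding central_part_def by (auto intro!: bexI [of _ g] simp: distrib)
    qed
  next
    fix r x assume r: "r \<in> C" and "x \<in> central_part J"
    then obtain e where x: "x \<in> J" "x \<in> C" and e: "e \<in> J" "central_idem e" "e \<odot> x = x" "e \<in> C"
      using JD(3) by (auto simp: central_part_def)
    have "e \<odot> (r \<odot> x) = r \<odot> x" using comm [OF e(2) r] r x e by (metis mul_assoc)
    moreover have "e \<odot> (x \<odot> r) = x \<odot> r" using r x e by (metis mul_assoc)
    ultimately show "r \<odot> x \<in> central_part J" "x \<odot> r \<in> central_part J"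
      using x e JD(4,5) r unfolding central_part_def by auto
  qed
qed

lemma central_part_common_unit:
  assumes J: "ideal A J"
  shows "finite F \<Longrightarrow> F \<subseteq> central_part J \<Longrightarrow> \<exists>e\<in>J. central_idem e \<and> (\<forall>x\<in>F. e \<odot> x = x)"
proof (induction rule: finite_induct)
  case empty
  then show ?case
    using subspaceD(2) [OF idealD(2) [OF J]] unfolding central_idem_def by (auto intro!: bexI [of _ \<zero>])
next
  case (insert x F)
  then obtain e where e: "e \<in> J" "central_idem e" "\<forall>x\<in>F. e \<odot> x = x" by auto
  obtain f where f: "f \<in> J" "central_idem f" "f \<odot> x = x" using insert by (auto simp: central_part_def)
  have C: "insert x F \<subseteq> C" using insert.prems idealD(3) [OF J] by (auto simp: central_part_def)
  obtain g where "g \<in> J" "central_idem g"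
    "\<And>x. x \<in> C \<Longrightarrow> e \<odot> x = x \<Longrightarrow> g \<odot> x = x" "\<And>x. x \<in> C \<Longrightarrow> f \<odot> x = x \<Longrightarrow> g \<odot> x = x"
    using central_idem_join [OF J e(1,2) f(1,2)] by metis
  then show ?case using e f C by (intro bexI [of _ g]) auto
qed

lemma apow_central_compl:
  assumes e: "central_idem e" and x: "x \<in> C"
  shows "apow A (x \<oplus> \<ominus> (e \<odot> x)) (Suc k) = apow A x (Suc k) \<oplus> \<ominus> (e \<odot> apow A x (Suc k))"
proof (induction k)
  case (Suc k)
  let ?y = "x \<oplus> \<ominus> (e \<odot> x)" and ?v = "apow A x (Suc k)"
  have eC: "e \<in> C" and ee: "e \<odot> e = e" and ex: "e \<odot> x = x \<odot> e" using e x unfolding central_idem_def by auto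
  have vC: "?v \<in> C" using x by (rule apow_closed)
  have 1: "x \<odot> (e \<odot> ?v) = e \<odot> (x \<odot> ?v)" using ex x eC vC by (metis mul_assoc)
  have 2: "e \<odot> (e \<odot> (x \<odot> ?v)) = e \<odot> (x \<odot> ?v)" using ee x eC vC by (metis mul_assoc closed(3))
  have "apow A ?y (Suc (Suc k)) = ?y \<odot> apow A ?y (Suc k)" by simp
  also have "\<dots> = ?y \<odot> (?v \<oplus> \<ominus> (e \<odot> ?v))" by (simp only: Suc)
  also have "\<dots> = x \<odot> ?v \<oplus> \<ominus> (e \<odot> (x \<odot> ?v))"
    using x eC vC 1 2 by (simp add: distrib neg_mul neg_add mul_assoc del: apow.simps)
  finally show ?case by simp
qed simp

text \<open>Nilpotence modulo the central part becomes honest nilpotence: if \<open>e\<close> fixes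
  x^m, then y = (1 - e) x satisfies y^m = 0. The index bound applies to \<open>y\<close>, so y^N is
  centrally covered, and x^N = y^N + e x^N.\<close>

lemma central_part_index:
  assumes J: "ideal A J" and reg: "regular J" and N: "N > 0"
    and index: "\<And>u. u \<in> J \<Longrightarrow> nilpotent_elt A u \<Longrightarrow> apow A u (Suc N) = \<zero>"
    and x: "x \<in> J" "m > 0" "apow A x m \<in> central_part J"
  shows "apow A x N \<in> central_part J"
proof -
  note JD = idealD [OF J]
  have powJ: "apow A u (Suc i) \<in> J" if "u \<in> J" for u i
    using that JD(3,4) by (induction i) auto
  have xC: "x \<in> C" using x JD by auto
  obtain e where e: "e \<in> J" "central_idem e" "e \<odot> apow A x m = apow A x m"
    using x by (auto simp: central_part_def)
  have eC: "e \<in> C" using e JD by auto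
  define y where "y = x \<oplus> \<ominus> (e \<odot> x)"
  have yJ: "y \<in> J" using x eC JD(4) subspaceD(3,6) [OF JD(2)] by (simp add: y_def)
  have ypow: "apow A y i = apow A x i \<oplus> \<ominus> (e \<odot> apow A x i)" if "i > 0" for i
    using apow_central_compl [OF e(2) xC, of "i - 1"] that by (simp add: y_def)
  have "apow A y m = \<zero>" using ypow [OF x(2)] e xC by simp
  then have "nilpotent_elt A y" using x(2) unfolding nilpotent_elt_def by auto
  then have "apow A y (Suc N) = \<zero>" using index yJ by blast
  moreover have yN: "apow A y N \<in> J" using powJ [OF yJ, of "N - 1"] N by simp
  ultimately have "apow A y N \<in> central_part J"
    using central_cover_power [OF J reg N index yJ] by (auto simp: central_part_def)
  moreover have "e \<in> central_part J" using e unfolding central_part_def central_idem_def by blast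
  then have "e \<odot> apow A x N \<in> central_part J"
    using idealD(5) [OF ideal_central_part [OF J]] xC by auto
  ultimately have "apow A y N \<oplus> e \<odot> apow A x N \<in> central_part J"
    using subspaceD(3) [OF idealD(2) [OF ideal_central_part [OF J]]] by blast
  then show ?thesis using ypow [OF N] xC eC by simp
qed

lemma subspace_image:
  assumes f: "\<And>x. x \<in> C \<Longrightarrow> f x \<in> C" "\<And>x y. x \<in> C \<Longrightarrow> y \<in> C \<Longrightarrow> f (x \<oplus> y) = f x \<oplus> f y"
    "\<And>c x. x \<in> C \<Longrightarrow> f (c \<bullet> x) = c \<bullet> f x" and W: "subspace W"
  shows "subspace (f ` W)"
proof -
  note D = subspaceD [OF W]
  have "f (0 \<bullet> \<zero>) = 0 \<bullet> f \<zero>" using f(3) [of \<zero> 0] by blast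
  then have "f \<zero> = \<zero>" using f(1) by simp
  then have "\<zero> \<in> f ` W" using D(2) by (metis imageI)
  then show ?thesis
    using D f(1) unfolding subspace_def by (auto simp flip: f(2,3))
qed

lemma sspan_image:
  assumes f: "\<And>x. x \<in> C \<Longrightarrow> f x \<in> C" "\<And>x y. x \<in> C \<Longrightarrow> y \<in> C \<Longrightarrow> f (x \<oplus> y) = f x \<oplus> f y"
    "\<And>c x. x \<in> C \<Longrightarrow> f (c \<bullet> x) = c \<bullet> f x" and bs: "set bs \<subseteq> C"
  shows "f ` sspan bs \<subseteq> sspan (map f bs)"
  using bs
proof (induction bs)
  case Nil
  have "f (0 \<bullet> \<zero>) = 0 \<bullet> f \<zero>" using f(3) [of \<zero> 0] by blast
  then show ?case using f(1) by simp
next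
  case (Cons b bs)
  have "f (c \<bullet> b \<oplus> v) = c \<bullet> f b \<oplus> f v" if "v \<in> sspan bs" for c v
    using that f Cons.prems subspaceD(5) [OF subspace_sspan, of bs v] by simp
  then show ?case using Cons by (fastforce simp: sspan_Cons)
qed

section \<open>Local regularity modulo an ideal\<close>

definition cong_mod where "cong_mod M x y \<longleftrightarrow> x \<in> C \<and> y \<in> C \<and> x \<oplus> \<ominus> y \<in> M"

lemma cong_mod_sym:
  assumes "ideal A M" "cong_mod M x y" shows "cong_mod M y x"
proof -
  have "\<ominus> (x \<oplus> \<ominus> y) = y \<oplus> \<ominus> x" using assms by (simp add: cong_mod_def neg_add add_comm)
  then show ?thesis using assms subspaceD(6) [OF idealD(2) [OF assms(1)]] unfolding cong_mod_def by metis
qed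

lemma cong_mod_trans:
  assumes "ideal A M" "cong_mod M x y" "cong_mod M y z" shows "cong_mod M x z"
proof -
  have "(x \<oplus> \<ominus> y) \<oplus> (y \<oplus> \<ominus> z) = x \<oplus> \<ominus> z" using assms by (simp add: cong_mod_def add_assoc)
  then show ?thesis using assms subspaceD(3) [OF idealD(2) [OF assms(1)]] unfolding cong_mod_def by metis
qed

lemma cong_mod_add:
  assumes "ideal A M" "cong_mod M x y" "cong_mod M z w" shows "cong_mod M (x \<oplus> z) (y \<oplus> w)"
proof -
  have "(x \<oplus> \<ominus> y) \<oplus> (z \<oplus> \<ominus> w) = x \<oplus> z \<oplus> \<ominus> (y \<oplus> w)"
    using assms by (simp add: cong_mod_def neg_add add_assoc add_left_comm [of _ z])
  then show ?thesis using assms subspaceD(3) [OF idealD(2) [OF assms(1)]] unfolding cong_mod_def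
    by (metis closed(2))
qed

lemma cong_mod_mul:
  assumes "ideal A M" "cong_mod M x y" "z \<in> C"
  shows "cong_mod M (x \<odot> z) (y \<odot> z)" "cong_mod M (z \<odot> x) (z \<odot> y)"
proof -
  have "(x \<oplus> \<ominus> y) \<odot> z = x \<odot> z \<oplus> \<ominus> (y \<odot> z)" "z \<odot> (x \<oplus> \<ominus> y) = z \<odot> x \<oplus> \<ominus> (z \<odot> y)"
    using assms by (simp_all add: cong_mod_def distrib neg_mul)
  then show "cong_mod M (x \<odot> z) (y \<odot> z)" "cong_mod M (z \<odot> x) (z \<odot> y)"
    using assms idealD(4,5) [OF assms(1)] unfolding cong_mod_def by (metis closed(3))+
qed

definition fd_regular where
  "fd_regular S \<longleftrightarrow> subalg A S \<and> regular S \<and> (\<exists>bs. set bs \<subseteq> S \<and> S \<subseteq> sspan bs)"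

text \<open>For an ideal \<open>M\<close> this is local finite-dimensional regularity of the
  quotient by \<open>M\<close>, phrased inside \<open>A\<close>. The subalgebra \<open>S\<close>
  itself may be infinite-dimensional, since \<open>bs\<close> spans it only modulo
  \<open>M\<close>.\<close>

definition locally_fd_regular_mod where
  "locally_fd_regular_mod M \<longleftrightarrow> (\<forall>F. finite F \<longrightarrow> F \<subseteq> C \<longrightarrow> (\<exists>S bs. subalg A S \<and> F \<subseteq> S \<and> set bs \<subseteq> S \<and>
     (\<forall>x\<in>S. \<exists>v\<in>sspan bs. cong_mod M x v) \<and> (\<forall>x\<in>S. \<exists>y\<in>S. cong_mod M (x \<odot> y \<odot> x) x)))"

lemma locally_fd_regular_modE:
  assumes "locally_fd_regular_mod M" "finite F" "F \<subseteq> C"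
  obtains S bs where "subalg A S" "F \<subseteq> S" "set bs \<subseteq> S"
    "\<forall>x\<in>S. \<exists>v\<in>sspan bs. cong_mod M x v" "\<forall>x\<in>S. \<exists>y\<in>S. cong_mod M (x \<odot> y \<odot> x) x"
  using assms unfolding locally_fd_regular_mod_def by meson

lemma subalgD:
  assumes "subalg A S"
  shows "subspace S" "S \<subseteq> C" "x \<in> S \<Longrightarrow> y \<in> S \<Longrightarrow> x \<odot> y \<in> S" "x \<in> S \<Longrightarrow> x \<in> C"
  using assms unfolding subalg_def subspace_def by auto

lemma subalgI:
  assumes "subspace S" "\<And>x y. x \<in> S \<Longrightarrow> y \<in> S \<Longrightarrow> x \<odot> y \<in> S"
  shows "subalg A S"
  using assms subspaceD [OF assms(1)] unfolding subalg_def by auto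

lemma sspan_subset_subalg: "subalg A S \<Longrightarrow> set bs \<subseteq> S \<Longrightarrow> sspan bs \<subseteq> S"
  using subalgD(1) sspan_least by blast

lemma cong_mod_zero: "cong_mod {\<zero>} x y \<longleftrightarrow> x \<in> C \<and> x = y"
  using diff_zero_iff by (auto simp: cong_mod_def)

lemma locally_fd_regular_mod_zero:
  "locally_fd_regular_mod {\<zero>} \<longleftrightarrow> (\<forall>F. finite F \<longrightarrow> F \<subseteq> C \<longrightarrow> (\<exists>S. fd_regular S \<and> F \<subseteq> S))"
proof -
  have *: "(subalg A S \<and> F \<subseteq> S \<and> set bs \<subseteq> S \<and> (\<forall>x\<in>S. \<exists>v\<in>sspan bs. cong_mod {\<zero>} x v) \<and>
      (\<forall>x\<in>S. \<exists>y\<in>S. cong_mod {\<zero>} (x \<odot> y \<odot> x) x)) \<longleftrightarrow>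
     subalg A S \<and> regular S \<and> F \<subseteq> S \<and> set bs \<subseteq> S \<and> S \<subseteq> sspan bs" for S F bs
    using subalgD(4) [of S] by (auto simp: cong_mod_zero regular_def subset_eq)
  show ?thesis unfolding locally_fd_regular_mod_def fd_regular_def * by (simp add: conj_ac)
qed

lemma restr_k_algebra: "subalg A S \<Longrightarrow> k_algebra (restr A S)"
  using kalg by unfold_locales (auto simp: is_kalg_def subalg_def subset_eq)

lemma lincomb_restr: "lincomb (restr A S) cs bs = lincomb A cs bs"
  by (induction A cs bs rule: lincomb.induct) auto

lemma fd_semisimple_restr: "subalg A S \<Longrightarrow> fd_semisimple (restr A S) \<longleftrightarrow> fd_regular S"
  unfolding k_algebra.fd_semisimple_iff [OF restr_k_algebra] fd_regular_def
    k_algebra.regular_def [OF restr_k_algebra] regular_def k_algebra.sspan_def [OF restr_k_algebra] sspan_def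
  by (auto simp: lincomb_restr)

lemma locally_fdss_iff: "locally_fdss A \<longleftrightarrow> locally_fd_regular_mod {\<zero>}"
proof -
  have *: "(\<exists>S. subalg A S \<and> F \<subseteq> S \<and> fd_semisimple (restr A S)) \<longleftrightarrow> (\<exists>S. fd_regular S \<and> F \<subseteq> S)" for F
    using fd_semisimple_restr by (metis fd_regular_def)
  show ?thesis unfolding locally_fdss_def locally_fd_regular_mod_zero by (simp only: * imp_conjL)
qed

lemma fd_regular_sum:
  assumes U: "fd_regular U" and W: "fd_regular W"
    and orth: "\<And>u w. u \<in> U \<Longrightarrow> w \<in> W \<Longrightarrow> u \<odot> w = \<zero> \<and> w \<odot> u = \<zero>"
  shows "fd_regular {u \<oplus> w | u w. u \<in> U \<and> w \<in> W}" (is "fd_regular ?S")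
proof -
  have sU: "subalg A U" and sW: "subalg A W" using U W unfolding fd_regular_def by auto
  note UD = subalgD [OF sU] subspaceD [OF subalgD(1) [OF sU]]
  note WD = subalgD [OF sW] subspaceD [OF subalgD(1) [OF sW]]
  have mul: "(u \<oplus> w) \<odot> (u' \<oplus> w') = u \<odot> u' \<oplus> w \<odot> w'"
    if "u \<in> U" "w \<in> W" "u' \<in> U" "w' \<in> W" for u w u' w'
    using that orth [of u w'] orth [of u' w] UD(4) WD(4) by (simp add: distrib)
  have sub: "subalg A ?S"
  proof (rule subalgI)
    show "subspace ?S"
      unfolding subspace_def
    proof (intro conjI ballI allI)
      show "?S \<subseteq> C" using UD(4) WD(4) by auto
      have "\<zero> = \<zero> \<oplus> \<zero>" by simp
      then show "\<zero> \<in> ?S" using UD(6) WD(6) by blast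
      fix x assume "x \<in> ?S"
      then obtain u w where x: "x = u \<oplus> w" "u \<in> U" "w \<in> W" by auto
      have "c \<bullet> x = c \<bullet> u \<oplus> c \<bullet> w" for c using x UD(4) WD(4) by (simp add: smul_distrib)
      then show "c \<bullet> x \<in> ?S" for c using x UD(8) WD(8) by blast
      fix y assume "y \<in> ?S"
      then obtain u' w' where y: "y = u' \<oplus> w'" "u' \<in> U" "w' \<in> W" by auto
      have "x \<oplus> y = (u \<oplus> u') \<oplus> (w \<oplus> w')"
        using x y UD(4) WD(4) by (simp add: add_assoc add_left_comm [of w])
      then show "x \<oplus> y \<in> ?S" using x y UD(7) WD(7) by blast
    qed
    show "x \<odot> y \<in> ?S" if "x \<in> ?S" "y \<in> ?S" for x y
      using that mul UD(3) WD(3) by (smt (verit, best) mem_Collect_eq)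
  qed
  have reg: "regular ?S"
    unfolding regular_def
  proof
    fix x assume "x \<in> ?S"
    then obtain u w where x: "x = u \<oplus> w" "u \<in> U" "w \<in> W" by auto
    obtain u' where u': "u' \<in> U" "u \<odot> u' \<odot> u = u" using U x unfolding fd_regular_def regular_def by blast
    obtain w' where w': "w' \<in> W" "w \<odot> w' \<odot> w = w" using W x unfolding fd_regular_def regular_def by blast
    have "x \<odot> (u' \<oplus> w') \<odot> x = x" using x u' w' UD(3) WD(3) by (simp add: mul)
    then show "\<exists>y\<in>?S. x \<odot> y \<odot> x = x" using u' w' by blast
  qed
  obtain bs where bs: "set bs \<subseteq> U" "U \<subseteq> sspan bs" using U unfolding fd_regular_def by auto
  obtain cs where cs: "set cs \<subseteq> W" "W \<subseteq> sspan cs" using W unfolding fd_regular_def by auto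
  have C: "set (bs @ cs) \<subseteq> C" using bs cs UD(4) WD(4) by auto
  have U_sub: "u \<in> ?S" if "u \<in> U" for u using that add_zero(2) [OF UD(4) [OF that], symmetric] WD(6) by blast
  have W_sub: "w \<in> ?S" if "w \<in> W" for w using that add_zero(1) [OF WD(4) [OF that], symmetric] UD(6) by blast
  have "set (bs @ cs) \<subseteq> ?S" using bs cs U_sub W_sub by auto
  moreover have "?S \<subseteq> sspan (bs @ cs)"
  proof -
    have "U \<subseteq> sspan (bs @ cs)" "W \<subseteq> sspan (bs @ cs)"
      using bs(2) cs(2) sspan_mono [OF C, of bs] sspan_mono [OF C, of cs] by auto
    then show ?thesis using subspaceD(3) [OF subspace_sspan [OF C]] by blast
  qed
  ultimately show ?thesis using sub reg unfolding fd_regular_def by blast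
qed

end

section \<open>Transport along algebra homomorphisms\<close>

definition alg_hom :: "('k, 'a) kalg \<Rightarrow> ('k, 'b) kalg \<Rightarrow> ('a \<Rightarrow> 'b) \<Rightarrow> bool" where
  "alg_hom A B h \<longleftrightarrow> (\<forall>x\<in>carr A. h x \<in> carr B) \<and>
     (\<forall>x\<in>carr A. \<forall>y\<in>carr A. h (pls A x y) = pls B (h x) (h y)) \<and>
     (\<forall>x\<in>carr A. \<forall>y\<in>carr A. h (tms A x y) = tms B (h x) (h y)) \<and>
     (\<forall>c. \<forall>x\<in>carr A. h (scl A c x) = scl B c (h x))"

locale alg_homomorphism =
  fixes A :: "('k::field, 'a) kalg" and B :: "('k, 'b) kalg" and h :: "'a \<Rightarrow> 'b"
  assumes A: "k_algebra A" and B: "k_algebra B" and hom: "alg_hom A B h"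
begin

interpretation A: k_algebra A by (rule A)
interpretation B: k_algebra B by (rule B)

lemma hom_simps [simp]:
  "x \<in> carr A \<Longrightarrow> h x \<in> carr B"
  "x \<in> carr A \<Longrightarrow> y \<in> carr A \<Longrightarrow> h (pls A x y) = pls B (h x) (h y)"
  "x \<in> carr A \<Longrightarrow> y \<in> carr A \<Longrightarrow> h (tms A x y) = tms B (h x) (h y)"
  "x \<in> carr A \<Longrightarrow> h (scl A c x) = scl B c (h x)"
  using hom unfolding alg_hom_def by auto

lemma hom_zero [simp]: "h (zro A) = zro B"
  using B.idem_zero [of "h (zro A)"] by (simp flip: hom_simps(2))

lemma hom_neg [simp]: "x \<in> carr A \<Longrightarrow> h (ngt A x) = ngt B (h x)"
  using B.neg_unique [of "h x" "h (ngt A x)"] by (simp flip: hom_simps(2))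

lemma hom_sspan:
  assumes "set bs \<subseteq> carr A" shows "h ` A.sspan bs = B.sspan (map h bs)"
proof -
  have "h (lincomb A cs bs) = lincomb B cs (map h bs) \<and> lincomb A cs bs \<in> carr A" for cs
    using assms
  proof (induction bs arbitrary: cs)
    case (Cons b bs)
    then show ?case by (cases cs) auto
  qed simp
  then show ?thesis by (simp add: A.sspan_def B.sspan_def setcompr_eq_image image_image)
qed

lemma hom_apow: "x \<in> carr A \<Longrightarrow> h (apow A x n) = apow B (h x) n"
proof (induction n)
  case (Suc n)
  then show ?case by (cases n) auto
qed simp

lemma hom_subalg_image:
  assumes "subalg A S" shows "subalg B (h ` S)"
proof -
  have S: "x \<in> carr A" if "x \<in> S" for x using that assms by (auto simp: subalg_def)
  show ?thesis
    using assms S unfolding subalg_def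
    by (auto simp flip: hom_simps(2-4) hom_neg intro!: imageI) (metis hom_zero imageI)
qed

lemma hom_subalg_preimage:
  assumes "subalg B S" shows "subalg A {x \<in> carr A. h x \<in> S}"
  using assms unfolding subalg_def by auto

lemma hom_ideal_preimage:
  assumes "ideal B N" shows "ideal A {x \<in> carr A. h x \<in> N}"
  using assms unfolding ideal_def by auto

lemma hom_ideal_image:
  assumes surj: "h ` carr A = carr B" and I: "ideal A I" shows "ideal B (h ` I)"
proof -
  have C: "x \<in> carr A" if "x \<in> I" for x using that I by (auto simp: ideal_def)
  show ?thesis
    using I C unfolding ideal_def surj [symmetric]
    by (auto simp flip: hom_simps(2-4) hom_neg intro!: imageI) (metis hom_zero imageI)
qed

lemma hom_fd_regular_image:
  assumes "A.fd_regular S" shows "B.fd_regular (h ` S)"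
proof -
  have sub: "subalg A S" and reg: "A.regular S" using assms by (auto simp: A.fd_regular_def)
  obtain bs where bs: "set bs \<subseteq> S" "S \<subseteq> A.sspan bs" using assms by (auto simp: A.fd_regular_def)
  note S = A.subalgD(4) [OF sub]
  have "B.regular (h ` S)"
    unfolding B.regular_def
  proof
    fix x assume "x \<in> h ` S"
    then obtain s where s: "s \<in> S" "x = h s" by auto
    then obtain y where y: "y \<in> S" "tms A (tms A s y) s = s" using reg by (auto simp: A.regular_def)
    then have "tms B (tms B x (h y)) x = x" using s S by (simp flip: hom_simps(3))
    then show "\<exists>y\<in>h ` S. tms B (tms B x y) x = x" using y by blast
  qed
  moreover have "h ` S \<subseteq> B.sspan (map h bs)" using hom_sspan [of bs] bs S by blast
  moreover have "set (map h bs) \<subseteq> h ` S" using bs by auto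
  ultimately show ?thesis using hom_subalg_image [OF sub] unfolding B.fd_regular_def by blast
qed

lemma hom_cong_mod:
  assumes "x \<in> carr A" "y \<in> carr A"
  shows "A.cong_mod {x \<in> carr A. h x \<in> N} x y \<longleftrightarrow> B.cong_mod N (h x) (h y)"
  using assms by (simp add: A.cong_mod_def B.cong_mod_def)

lemma locally_fd_regular_mod_image:
  assumes surj: "h ` carr A = carr B" and L: "A.locally_fd_regular_mod {x \<in> carr A. h x \<in> N}"
  shows "B.locally_fd_regular_mod N"
  unfolding B.locally_fd_regular_mod_def
proof (intro allI impI)
  fix F assume F: "finite F" "F \<subseteq> carr B"
  then obtain F' where F': "F' \<subseteq> carr A" "finite F'" "F = h ` F'"
    using surj finite_subset_image by metis
  let ?M = "{x \<in> carr A. h x \<in> N}"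
  obtain S bs where sub: "subalg A S" and S: "F' \<subseteq> S" "set bs \<subseteq> S"
    and sp: "\<forall>x\<in>S. \<exists>v\<in>A.sspan bs. A.cong_mod ?M x v"
    and reg: "\<forall>x\<in>S. \<exists>y\<in>S. A.cong_mod ?M (tms A (tms A x y) x) x"
    using A.locally_fd_regular_modE [OF L F'(2,1)] .
  note SC = A.subalgD(4) [OF sub]
  have bsC: "set bs \<subseteq> carr A" using S SC by auto
  show "\<exists>S bs. subalg B S \<and> F \<subseteq> S \<and> set bs \<subseteq> S \<and> (\<forall>x\<in>S. \<exists>v\<in>B.sspan bs. B.cong_mod N x v) \<and>
      (\<forall>x\<in>S. \<exists>y\<in>S. B.cong_mod N (tms B (tms B x y) x) x)"
  proof (intro exI conjI ballI)
    show "subalg B (h ` S)" by (rule hom_subalg_image [OF sub])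
    show "F \<subseteq> h ` S" using F' S by auto
    show "set (map h bs) \<subseteq> h ` S" using S by auto
    fix x assume "x \<in> h ` S"
    then obtain s where s: "s \<in> S" "x = h s" by auto
    obtain v where v: "v \<in> A.sspan bs" "A.cong_mod ?M s v" using sp s by blast
    then have "h v \<in> B.sspan (map h bs)" "v \<in> carr A"
      using hom_sspan [OF bsC] A.subspaceD(5) [OF A.subspace_sspan [OF bsC]] by auto
    then show "\<exists>v\<in>B.sspan (map h bs). B.cong_mod N x v"
      using v s SC hom_cong_mod by blast
    obtain y where y: "y \<in> S" "A.cong_mod ?M (tms A (tms A s y) s) s" using reg s by blast
    then have "B.cong_mod N (h (tms A (tms A s y) s)) (h s)" using s SC by (subst hom_cong_mod [symmetric]) auto
    then show "\<exists>y\<in>h ` S. B.cong_mod N (tms B (tms B x y) x) x" using y s SC by auto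
  qed
qed

text \<open>The subalgebra upstairs is a full preimage. It contains the kernel and so is in general
  not finite-dimensional, but lifts of a spanning list span it modulo \<open>?M\<close>.\<close>

lemma locally_fd_regular_mod_preimage:
  assumes surj: "h ` carr A = carr B" and L: "B.locally_fd_regular_mod N"
  shows "A.locally_fd_regular_mod {x \<in> carr A. h x \<in> N}"
  unfolding A.locally_fd_regular_mod_def
proof (intro allI impI)
  fix F assume F: "finite F" "F \<subseteq> carr A"
  let ?M = "{x \<in> carr A. h x \<in> N}"
  have "finite (h ` F)" "h ` F \<subseteq> carr B" using F by auto
  then obtain S bs where sub: "subalg B S" and S: "h ` F \<subseteq> S" "set bs \<subseteq> S"
    and sp: "\<forall>x\<in>S. \<exists>v\<in>B.sspan bs. B.cong_mod N x v"
    and reg: "\<forall>x\<in>S. \<exists>y\<in>S. B.cong_mod N (tms B (tms B x y) x) x"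
    using B.locally_fd_regular_modE [OF L] by metis
  note SC = B.subalgD(4) [OF sub]
  define cs where "cs = map (inv_into (carr A) h) bs"
  have lift: "inv_into (carr A) h b \<in> carr A" "h (inv_into (carr A) h b) = b" if "b \<in> carr B" for b
    using that surj by (auto simp: inv_into_into f_inv_into_f)
  have csC: "set cs \<subseteq> carr A" using S SC lift by (auto simp: cs_def)
  have hcs: "map h cs = bs" using S SC lift by (auto simp: cs_def intro!: map_idI)
  show "\<exists>S bs. subalg A S \<and> F \<subseteq> S \<and> set bs \<subseteq> S \<and> (\<forall>x\<in>S. \<exists>v\<in>A.sspan bs. A.cong_mod ?M x v) \<and>
      (\<forall>x\<in>S. \<exists>y\<in>S. A.cong_mod ?M (tms A (tms A x y) x) x)"
  proof (intro exI conjI ballI)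
    show "subalg A {x \<in> carr A. h x \<in> S}" by (rule hom_subalg_preimage [OF sub])
    show "F \<subseteq> {x \<in> carr A. h x \<in> S}" using F S by auto
    show "set cs \<subseteq> {x \<in> carr A. h x \<in> S}" using csC S hcs by auto
    fix x assume x: "x \<in> {x \<in> carr A. h x \<in> S}"
    obtain w where w: "w \<in> B.sspan bs" "B.cong_mod N (h x) w" using sp x by blast
    then obtain v where v: "v \<in> A.sspan cs" "w = h v" using hom_sspan [OF csC] hcs by auto
    then have "v \<in> carr A" using A.subspaceD(5) [OF A.subspace_sspan [OF csC]] by auto
    then show "\<exists>v\<in>A.sspan cs. A.cong_mod ?M x v" using v w x hom_cong_mod by auto
    obtain y where y: "y \<in> S" "B.cong_mod N (tms B (tms B (h x) y) (h x)) (h x)" using reg x by blast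
    let ?y = "inv_into (carr A) h y"
    have yy: "?y \<in> carr A" "h ?y = y" using y SC lift by auto
    then have "A.cong_mod ?M (tms A (tms A x ?y) x) x" using y x by (subst hom_cong_mod) auto
    then show "\<exists>y\<in>{x \<in> carr A. h x \<in> S}. A.cong_mod ?M (tms A (tms A x y) x) x"
      using yy y by (intro bexI [of _ ?y]) auto
  qed
qed

end

section \<open>Extensions by the central part\<close>

context k_algebra
begin

lemma central_idem_hom:
  assumes "central_idem e" shows "alg_homomorphism A A ((\<odot>) e)"
proof -
  have e: "e \<in> C" "e \<odot> e = e" "\<And>y. y \<in> C \<Longrightarrow> e \<odot> y = y \<odot> e" using assms unfolding central_idem_def by auto
  have "e \<odot> (x \<odot> y) = e \<odot> x \<odot> (e \<odot> y)" if "x \<in> C" "y \<in> C" for x y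
    using e that by (metis mul_assoc closed(3))
  then show ?thesis
    using e(1) k_algebra_axioms by (intro alg_homomorphism.intro) (auto simp: alg_hom_def distrib smul_mul)
qed

text \<open>Only finitely many dimensions of \<open>central_part J\<close> obstruct a lift, so one
  central \<open>e\<close> removes them all. The complement x - e x of the lift becomes a genuine
  subalgebra, and the lost part \<open>e F\<close> is recovered from local regularity of
  \<open>J\<close>.\<close>

lemma central_extension:
  assumes J: "ideal A J" and locJ: "\<And>F. finite F \<Longrightarrow> F \<subseteq> J \<Longrightarrow> \<exists>S. fd_regular S \<and> F \<subseteq> S"
    and L: "locally_fd_regular_mod (central_part J)"
  shows "locally_fd_regular_mod {\<zero>}"
  unfolding locally_fd_regular_mod_zero
proof (intro allI impI)
  fix F assume F: "finite F" "F \<subseteq> C"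
  define M where "M = central_part J"
  have M: "ideal A M" unfolding M_def by (rule ideal_central_part [OF J])
  obtain T bs0 where sT: "subalg A T" and T: "F \<subseteq> T" "set bs0 \<subseteq> T"
    and sp0: "\<forall>x\<in>T. \<exists>v\<in>sspan bs0. cong_mod M x v"
    and reg: "\<forall>x\<in>T. \<exists>y\<in>T. cong_mod M (x \<odot> y \<odot> x) x"
    using locally_fd_regular_modE [OF L F] unfolding M_def .
  note TD = subalgD [OF sT]
  obtain fs where fs: "set fs = F" using F finite_list by auto
  \<comment> \<open>The list \<open>bs0\<close> represents \<open>F\<close> only modulo
    \<open>M\<close>; adding \<open>fs\<close> puts \<open>F\<close> itself into
    \<open>V\<close>.\<close>
  define bs where "bs = fs @ bs0"
  have bsT: "set bs \<subseteq> T" and bsC: "set bs \<subseteq> C" using T fs TD(2) by (auto simp: bs_def)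
  define V where "V = sspan bs"
  have sV: "subspace V" unfolding V_def by (rule subspace_sspan [OF bsC])
  note VD = subspaceD [OF sV]
  have VT: "V \<subseteq> T" unfolding V_def by (rule sspan_subset_subalg [OF sT bsT])
  have FV: "F \<subseteq> V" using sspan_superset [OF bsC] fs by (auto simp: V_def bs_def)
  have sp: "\<exists>v\<in>V. cong_mod M x v" if "x \<in> T" for x
    using sp0 that sspan_mono [OF bsC, of bs0] by (auto simp: V_def bs_def)
  \<comment> \<open>The span \<open>P\<close> contains \<open>V\<close> and all products of two
    elements of \<open>V\<close>. Thus every comparison of a product with its representative in
    \<open>V\<close> takes place in one finite-dimensional space.\<close>
  define ps where "ps = bs @ concat (map (\<lambda>b. map ((\<odot>) b) bs) bs)"
  have psC: "set ps \<subseteq> C" using bsC by (auto simp: ps_def)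
  define P where "P = sspan ps"
  have sP: "subspace P" unfolding P_def by (rule subspace_sspan [OF psC])
  note PD = subspaceD [OF sP]
  have psP: "set ps \<subseteq> P" unfolding P_def by (rule sspan_superset [OF psC])
  have VP: "V \<subseteq> P" unfolding V_def P_def using psC by (intro sspan_mono) (auto simp: ps_def)
  have VVP: "v \<odot> w \<in> P" if "v \<in> V" "w \<in> V" for v w
  proof -
    have "subspace {v \<in> C. \<forall>b\<in>set bs. v \<odot> b \<in> P}"
      unfolding subspace_def using bsC PD by (auto simp: distrib smul_mul subset_eq)
    moreover have "set bs \<subseteq> {v \<in> C. \<forall>b\<in>set bs. v \<odot> b \<in> P}" using bsC psP by (auto simp: ps_def subset_eq)
    ultimately have "V \<subseteq> {v \<in> C. \<forall>b\<in>set bs. v \<odot> b \<in> P}" unfolding V_def by (rule sspan_least)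
    then have "set bs \<subseteq> {w \<in> C. v \<odot> w \<in> P}" using bsC \<open>v \<in> V\<close> by auto
    moreover have "subspace {w \<in> C. v \<odot> w \<in> P}"
      unfolding subspace_def using VD(5) [OF \<open>v \<in> V\<close>] PD by (auto simp: distrib smul_mul)
    ultimately have "V \<subseteq> {w \<in> C. v \<odot> w \<in> P}" unfolding V_def by (intro sspan_least)
    then show ?thesis using that by auto
  qed
  \<comment> \<open>All structure defects v w - u lie in this intersection, so it is enough that
    \<open>e\<close> fixes a finite spanning list of it.\<close>
  obtain ws where ws: "set ws \<subseteq> P \<inter> M" "P \<inter> M \<subseteq> sspan ws"
    using subspace_finitely_spanned [OF psC, of "P \<inter> M"] subspace_Int [OF sP idealD(2) [OF M]]
    unfolding P_def by auto
  obtain e where e: "e \<in> J" "central_idem e" "\<forall>w\<in>set ws. e \<odot> w = w"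
    using central_part_common_unit [OF J, of "set ws"] ws unfolding M_def by auto
  have eC: "e \<in> C" and ee: "e \<odot> e = e" and comm: "\<And>y. y \<in> C \<Longrightarrow> e \<odot> y = y \<odot> e"
    using e unfolding central_idem_def by auto
  have fixed: "e \<odot> m = m" if "m \<in> P" "m \<in> M" for m
  proof -
    have "subspace {m \<in> C. e \<odot> m = m}" unfolding subspace_def using eC by (auto simp: distrib smul_mul)
    then have "sspan ws \<subseteq> {m \<in> C. e \<odot> m = m}" using ws e PD(5) by (intro sspan_least) auto
    then show ?thesis using ws that by blast
  qed
  define q where "q v = v \<oplus> \<ominus> (e \<odot> v)" for v
  have qC: "q v \<in> C" if "v \<in> C" for v using that eC by (simp add: q_def)
  have eq: "e \<odot> q v = \<zero>" if "v \<in> C" for v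
    using that eC ee by (simp add: q_def distrib neg_mul flip: mul_assoc)
  have q_mul: "q v \<odot> q w = q (v \<odot> w)" if "v \<in> C" "w \<in> C" for v w
  proof -
    have "q v \<odot> q w = v \<odot> q w \<oplus> \<ominus> (e \<odot> (v \<odot> q w))"
      using that eC qC by (simp add: q_def [of v] distrib neg_mul mul_assoc)
    also have "e \<odot> (v \<odot> q w) = v \<odot> (e \<odot> q w)" using comm [of v] that eC qC by (metis mul_assoc)
    also have "v \<odot> q w = q (v \<odot> w)"
    proof -
      have "v \<odot> (e \<odot> w) = e \<odot> (v \<odot> w)" using comm [of v] that eC by (metis mul_assoc)
      then show ?thesis using that eC by (simp add: q_def distrib neg_mul)
    qed
    finally show ?thesis using that eq qC by simp
  qed
  \<comment> \<open>Confined to \<open>P\<close>, because \<open>e\<close> is known to absorb only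
    the part of \<open>M\<close> inside \<open>P\<close>.\<close>
  have q_cong: "q x = q y" if "cong_mod M x y" "x \<in> P" "y \<in> P" for x y
  proof -
    have C: "x \<in> C" "y \<in> C" using that PD by auto
    have "e \<odot> (x \<oplus> \<ominus> y) = x \<oplus> \<ominus> y"
      using that PD by (intro fixed) (auto simp: cong_mod_def)
    then have "q (x \<oplus> \<ominus> y) = \<zero>" using C eC by (simp add: q_def)
    moreover have "q (x \<oplus> \<ominus> y) = q x \<oplus> \<ominus> (q y)"
      using C eC by (simp add: q_def distrib neg_mul neg_add add_assoc add_comm add_left_comm)
    ultimately show ?thesis using qC C diff_zero_iff by auto
  qed
  have prod: "\<exists>u\<in>V. cong_mod M (v \<odot> w) u \<and> q v \<odot> q w = q u" if "v \<in> V" "w \<in> V" for v w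
  proof -
    have "v \<odot> w \<in> T" using TD(3) VT that by blast
    then obtain u where u: "u \<in> V" "cong_mod M (v \<odot> w) u" using sp by blast
    then have "q (v \<odot> w) = q u" using VVP that VP by (intro q_cong) auto
    then show ?thesis using u q_mul that VD(5) by auto
  qed
  have q_add: "q (x \<oplus> y) = q x \<oplus> q y" if "x \<in> C" "y \<in> C" for x y
    using that eC by (simp add: q_def distrib neg_add add_assoc add_left_comm [of _ y])
  have q_smul: "q (c \<bullet> x) = c \<bullet> q x" if "x \<in> C" for c x
    using that eC by (simp add: q_def smul_distrib smul_mul neg_eq_smul smul_smul mult.commute)
  have W: "fd_regular (q ` V)"
    unfolding fd_regular_def
  proof (intro conjI exI)
    show "subalg A (q ` V)"
    proof (rule subalgI)
      show "subspace (q ` V)" by (rule subspace_image [OF qC q_add q_smul sV])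
      show "x \<odot> y \<in> q ` V" if "x \<in> q ` V" "y \<in> q ` V" for x y using that prod by fastforce
    qed
    show "regular (q ` V)"
      unfolding regular_def
    proof
      fix x assume "x \<in> q ` V"
      then obtain v where v: "v \<in> V" "x = q v" by auto
      \<comment> \<open>A product of three elements of \<open>V\<close> may leave \<open>P\<close>.
        Each product of two is therefore brought back to \<open>V\<close> before the next factor;
        the final \<open>u'\<close> and \<open>v\<close> are congruent and both lie in
        \<open>V\<close>, where \<open>q_cong\<close> applies.\<close>
      obtain y where y: "y \<in> T" "cong_mod M (v \<odot> y \<odot> v) v" using reg v VT by blast
      obtain v' where v': "v' \<in> V" "cong_mod M y v'" using sp y by blast
      obtain u where u: "u \<in> V" "cong_mod M (v \<odot> v') u" "q v \<odot> q v' = q u" using prod v v' by blast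
      obtain u' where u': "u' \<in> V" "cong_mod M (u \<odot> v) u'" "q u \<odot> q v = q u'" using prod v u by blast
      have vC: "v \<in> C" using v VD by auto
      have "cong_mod M (v \<odot> y) u" using cong_mod_trans [OF M cong_mod_mul(2) [OF M v'(2) vC] u(2)] .
      then have "cong_mod M (v \<odot> y \<odot> v) u'"
        using cong_mod_trans [OF M cong_mod_mul(1) [OF M _ vC] u'(2)] by blast
      then have "cong_mod M u' v" using cong_mod_trans [OF M cong_mod_sym [OF M] y(2)] by blast
      then have "q u' = q v" using u' v VP by (intro q_cong) auto
      then have "x \<odot> q v' \<odot> x = x" using v u u' by simp
      then show "\<exists>y\<in>q ` V. x \<odot> y \<odot> x = x" using v' by blast
    qed
    show "set (map q bs) \<subseteq> q ` V" using sspan_superset [OF bsC] by (auto simp: V_def)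
    show "q ` V \<subseteq> sspan (map q bs)" unfolding V_def by (rule sspan_image [OF qC q_add q_smul bsC])
  qed
  interpret e: alg_homomorphism A A "(\<odot>) e" using central_idem_hom [OF e(2)] .
  \<comment> \<open>The subalgebra \<open>S\<close> need not be orthogonal to the image of
    \<open>q\<close>. Its image under \<open>e\<close> is, because \<open>e\<close> is central and
    kills every \<open>q v\<close>; that image still contains \<open>e F\<close> as \<open>e\<close>
    is idempotent.\<close>
  have "finite ((\<odot>) e ` F)" "(\<odot>) e ` F \<subseteq> J" using F e(1) idealD(5) [OF J] by auto
  then obtain S where S: "fd_regular S" "(\<odot>) e ` F \<subseteq> S" using locJ by blast
  then have U: "fd_regular ((\<odot>) e ` S)" by (intro e.hom_fd_regular_image)
  have SC: "s \<in> C" if "s \<in> S" for s using S that subalgD(4) unfolding fd_regular_def by blast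
  have "u \<odot> w = \<zero> \<and> w \<odot> u = \<zero>" if uw: "u \<in> (\<odot>) e ` S" "w \<in> q ` V" for u w
  proof -
    obtain s v where s: "s \<in> C" "v \<in> C" "u = e \<odot> s" "w = q v" using uw SC VD(5) by auto
    have "u \<odot> w = s \<odot> (e \<odot> w)" using s comm [of s] eC qC by (metis mul_assoc)
    moreover have "w \<odot> u = w \<odot> e \<odot> s" using s eC qC by (simp add: mul_assoc)
    moreover have "w \<odot> e = e \<odot> w" using comm qC s by simp
    ultimately show ?thesis using eq s by simp
  qed
  then have "fd_regular {u \<oplus> w | u w. u \<in> (\<odot>) e ` S \<and> w \<in> q ` V}"
    by (rule fd_regular_sum [OF U W])
  moreover have "F \<subseteq> {u \<oplus> w | u w. u \<in> (\<odot>) e ` S \<and> w \<in> q ` V}"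
  proof
    fix f assume f: "f \<in> F"
    then have fC: "f \<in> C" using F by auto
    have "f = e \<odot> f \<oplus> q f" using fC eC by (simp add: q_def add_left_comm [of _ f])
    moreover have "e \<odot> f \<in> (\<odot>) e ` S"
      using f S(2) fC eC ee by (intro image_eqI [of _ _ "e \<odot> f"]) (auto simp flip: mul_assoc)
    moreover have "q f \<in> q ` V" using f FV by auto
    ultimately show "f \<in> {u \<oplus> w | u w. u \<in> (\<odot>) e ` S \<and> w \<in> q ` V}" by blast
  qed
  ultimately show "\<exists>S. fd_regular S \<and> F \<subseteq> S" by blast
qed

section \<open>Quotients and the descent along the index\<close>

lemma cong_mod_neg: "ideal A M \<Longrightarrow> cong_mod M x y \<Longrightarrow> cong_mod M (\<ominus> x) (\<ominus> y)"
  using subspaceD(6) [OF idealD(2), of M "x \<oplus> \<ominus> y"] by (auto simp: cong_mod_def neg_add)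

lemma cong_mod_smul:
  assumes "ideal A M" "cong_mod M x y" shows "cong_mod M (c \<bullet> x) (c \<bullet> y)"
proof -
  have "c \<bullet> (x \<oplus> \<ominus> y) = c \<bullet> x \<oplus> \<ominus> (c \<bullet> y)"
    using assms by (simp add: cong_mod_def smul_distrib neg_eq_smul smul_smul mult.commute)
  then show ?thesis using assms subspaceD(4) [OF idealD(2) [OF assms(1)]] unfolding cong_mod_def
    by (metis closed(5))
qed

lemma cos_eq_iff:
  assumes I: "ideal A I" and C: "x \<in> C" "y \<in> C"
  shows "cos A I x = cos A I y \<longleftrightarrow> cong_mod I x y"
proof -
  have cos: "z \<in> cos A I u \<longleftrightarrow> cong_mod I z u" if "u \<in> C" for z u
    using that by (auto simp: cos_def cong_mod_def)
  have refl: "cong_mod I x x" using C subspaceD(2) [OF idealD(2) [OF I]] by (simp add: cong_mod_def)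
  show ?thesis
  proof
    assume "cos A I x = cos A I y"
    then show "cong_mod I x y" using refl cos [OF C(1), of x] cos [OF C(2), of x] by simp
  next
    assume xy: "cong_mod I x y"
    then have "cong_mod I z x \<longleftrightarrow> cong_mod I z y" for z
      using cong_mod_sym [OF I xy] cong_mod_trans [OF I] by metis
    then show "cos A I x = cos A I y" using cos C by (intro set_eqI) simp
  qed
qed

lemma rep_cos:
  assumes I: "ideal A I" and x: "x \<in> C"
  shows "cong_mod I (rep (cos A I x)) x"
proof -
  have "x \<in> cos A I x" using x subspaceD(2) [OF idealD(2) [OF I]] by (simp add: cos_def)
  then have "rep (cos A I x) \<in> cos A I x" unfolding rep_def by (rule someI)
  then show ?thesis using x by (simp add: cos_def cong_mod_def)
qed

lemma quot_simps:
  assumes I: "ideal A I" and C: "x \<in> C" "y \<in> C"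
  shows "pls (quot A I) (cos A I x) (cos A I y) = cos A I (x \<oplus> y)"
    "tms (quot A I) (cos A I x) (cos A I y) = cos A I (x \<odot> y)"
    "ngt (quot A I) (cos A I x) = cos A I (\<ominus> x)"
    "scl (quot A I) c (cos A I x) = cos A I (c \<bullet> x)"
proof -
  let ?r = "rep (cos A I x)" and ?s = "rep (cos A I y)"
  have x: "cong_mod I ?r x" and y: "cong_mod I ?s y" using rep_cos [OF I] C by auto
  have "?r \<in> C" "?s \<in> C" using x y by (auto simp: cong_mod_def)
  moreover have "cong_mod I (?r \<odot> ?s) (x \<odot> y)"
    using cong_mod_trans [OF I cong_mod_mul(1) [OF I x] cong_mod_mul(2) [OF I y]] C \<open>?s \<in> C\<close> by blast
  ultimately show "pls (quot A I) (cos A I x) (cos A I y) = cos A I (x \<oplus> y)"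
    "tms (quot A I) (cos A I x) (cos A I y) = cos A I (x \<odot> y)"
    "ngt (quot A I) (cos A I x) = cos A I (\<ominus> x)"
    "scl (quot A I) c (cos A I x) = cos A I (c \<bullet> x)"
    using C x y cong_mod_add [OF I x y] cong_mod_neg [OF I x] cong_mod_smul [OF I x]
    by (simp_all add: quot_def cos_eq_iff [OF I])
qed

lemma quot_carr: "carr (quot A I) = cos A I ` C" and quot_zro: "zro (quot A I) = cos A I \<zero>"
  by (simp_all add: quot_def)

lemma quot_k_algebra:
  assumes I: "ideal A I" shows "k_algebra (quot A I)"
proof
  show "is_kalg (quot A I)"
    unfolding is_kalg_def quot_carr quot_zro
    using quot_simps [OF I]
    by (auto simp: add_assoc mul_assoc distrib smul_mul smul_distrib smul_smul add_comm add_left_comm)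
qed

lemma quot_hom:
  assumes I: "ideal A I" shows "alg_homomorphism A (quot A I) (cos A I)"
proof
  show "alg_hom A (quot A I) (cos A I)"
    using quot_simps [OF I] by (auto simp: alg_hom_def quot_carr)
qed (use quot_k_algebra [OF I] kalg in \<open>auto simp: k_algebra_def\<close>)

lemma cos_eq_zero_iff:
  assumes "ideal A I" "x \<in> C" shows "cos A I x = zro (quot A I) \<longleftrightarrow> x \<in> I"
  using assms by (simp add: quot_zro cos_eq_iff) (simp add: cong_mod_def)

text \<open>In the quotient by \<open>I\<close>, the condition on powers modulo \<open>I\<close> is
  an honest index bound \<open>Suc N\<close> for the image of \<open>J\<close>. The ideal
  \<open>I'\<close> is the preimage of the central part of that image. For N = 0 the image is
  reduced and equals its central part.\<close>

lemma central_descent_step: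
  assumes J: "ideal A J" and locJ: "\<forall>F. finite F \<longrightarrow> F \<subseteq> J \<longrightarrow> (\<exists>S. fd_regular S \<and> S \<subseteq> J \<and> F \<subseteq> S)"
    and I: "ideal A I" "I \<subseteq> J"
    and index: "\<forall>x\<in>J. \<forall>m>0. apow A x m \<in> I \<longrightarrow> apow A x (Suc N) \<in> I"
  obtains I' where "ideal A I'" "I' \<subseteq> J" "N = 0 \<Longrightarrow> I' = J"
    "N > 0 \<Longrightarrow> \<forall>x\<in>J. \<forall>m>0. apow A x m \<in> I' \<longrightarrow> apow A x N \<in> I'"
    "locally_fd_regular_mod I' \<Longrightarrow> locally_fd_regular_mod I"
proof -
  let ?Q = "quot A I" and ?h = "cos A I"
  interpret Q: k_algebra ?Q by (rule quot_k_algebra [OF I(1)])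
  interpret h: alg_homomorphism A ?Q ?h by (rule quot_hom [OF I(1)])
  note ker = cos_eq_zero_iff [OF I(1)]
  note JD = idealD [OF J]
  let ?J = "?h ` J"
  have J': "ideal ?Q ?J" by (rule h.hom_ideal_image [OF quot_carr [symmetric] J])
  have J_iff: "?h x \<in> ?J \<longleftrightarrow> x \<in> J" if x: "x \<in> C" for x
  proof
    assume "?h x \<in> ?J"
    then obtain y where y: "y \<in> J" "?h x = ?h y" by auto
    then have "x \<oplus> \<ominus> y \<in> J" using I x JD(3) by (auto simp: cos_eq_iff cong_mod_def)
    then have "x \<oplus> \<ominus> y \<oplus> y \<in> J" using y subspaceD(3) [OF JD(2)] by blast
    then show "x \<in> J" using x y JD(3) by simp
  qed auto
  have locJ': "\<exists>S. Q.fd_regular S \<and> S \<subseteq> ?J \<and> F \<subseteq> S" if F: "finite F" "F \<subseteq> ?J" for F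
  proof -
    obtain F' where F': "F' \<subseteq> J" "finite F'" "F = ?h ` F'" using F finite_subset_image by metis
    then obtain S where "fd_regular S" "S \<subseteq> J" "F' \<subseteq> S" using locJ by blast
    then show ?thesis using h.hom_fd_regular_image F' by (intro exI [of _ "?h ` S"]) auto
  qed
  \<comment> \<open>The inclusion of \<open>S\<close> in the ideal, carried along in
    \<open>locJ\<close>, places the quasi-inverses inside the ideal.\<close>
  have reg: "Q.regular ?J"
    unfolding Q.regular_def
  proof
    fix x assume "x \<in> ?J"
    then obtain S where S: "Q.fd_regular S" "S \<subseteq> ?J" "x \<in> S" using locJ' [of "{x}"] by auto
    then obtain y where "y \<in> S" "tms ?Q (tms ?Q x y) x = x"
      unfolding Q.fd_regular_def Q.regular_def by metis
    then show "\<exists>y\<in>?J. tms ?Q (tms ?Q x y) x = x" using S(2) by (intro bexI [of _ y]) auto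
  qed
  have index': "apow ?Q u (Suc N) = zro ?Q" if u: "u \<in> ?J" "nilpotent_elt ?Q u" for u
  proof -
    obtain x where x: "x \<in> J" "u = ?h x" using u by auto
    then have xC: "x \<in> C" using JD(3) by auto
    obtain m where "m > 0" "apow ?Q u m = zro ?Q" using u(2) unfolding nilpotent_elt_def by blast
    then have "apow A x m \<in> I" using x xC ker [of "apow A x m"] by (simp add: h.hom_apow)
    then have "apow A x (Suc N) \<in> I" using index x \<open>m > 0\<close> by blast
    then show ?thesis using x xC ker [of "apow A x (Suc N)"] by (simp add: h.hom_apow del: apow.simps)
  qed
  define M where "M = Q.central_part ?J"
  define I' where "I' = {x \<in> C. ?h x \<in> M}"
  have I': "ideal A I'" unfolding I'_def M_def by (intro h.hom_ideal_preimage Q.ideal_central_part J')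
  have I'J: "I' \<subseteq> J" using J_iff by (auto simp: I'_def M_def Q.central_part_def)
  have step: "locally_fd_regular_mod I" if "locally_fd_regular_mod I'"
  proof -
    have "Q.locally_fd_regular_mod M"
      using that unfolding I'_def by (rule h.locally_fd_regular_mod_image [OF quot_carr [symmetric]])
    moreover have "\<exists>S. Q.fd_regular S \<and> F \<subseteq> S" if "finite F" "F \<subseteq> ?J" for F
      using locJ' [OF that] by (elim exE conjE) (rule exI, rule conjI)
    ultimately have "Q.locally_fd_regular_mod {zro ?Q}"
      unfolding M_def by (intro Q.central_extension [OF J'])
    then have "locally_fd_regular_mod {x \<in> C. ?h x \<in> {zro ?Q}}"
      by (rule h.locally_fd_regular_mod_preimage [OF quot_carr [symmetric]])
    moreover have "{x \<in> C. ?h x \<in> {zro ?Q}} = I" using ker idealD(3) [OF I(1)] by auto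
    ultimately show ?thesis by simp
  qed
  show ?thesis
  proof (rule that [OF I' I'J _ _ step])
    assume "N = 0"
    then have *: "u = zro ?Q" if "u \<in> ?J" "nilpotent_elt ?Q u" for u using index' [OF that] by simp
    have "?J \<subseteq> M"
    proof
      fix a assume a: "a \<in> ?J"
      show "a \<in> M"
        unfolding M_def Q.central_part_def
        by (intro CollectI conjI a Q.central_cover_reduced [OF J' reg * a])
    qed
    then show "I' = J" using I'J JD(3) by (auto simp: I'_def)
  next
    assume N: "N > 0"
    show "\<forall>x\<in>J. \<forall>m>0. apow A x m \<in> I' \<longrightarrow> apow A x N \<in> I'"
    proof (intro ballI allI impI)
      fix x and m :: nat assume x: "x \<in> J" "m > 0" "apow A x m \<in> I'"
      have xC: "x \<in> C" using x JD(3) by auto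
      have "apow ?Q (?h x) m \<in> M" using x xC by (simp add: I'_def h.hom_apow)
      then have "apow ?Q (?h x) N \<in> M"
        unfolding M_def by (rule Q.central_part_index [OF J' reg N index' _ x(2), rotated -1]) (use x in auto)
      then show "apow A x N \<in> I'" using xC by (simp add: I'_def h.hom_apow)
    qed
  qed
qed

text \<open>The recursion climbs from \<open>I\<close> to \<open>I'\<close> while \<open>N\<close>
  drops. At N = 0 it reaches \<open>J\<close>, where \<open>LJ\<close> applies, and local regularity
  is handed back down step by step.\<close>

lemma locally_fd_regular_mod_descent:
  assumes J: "ideal A J" and locJ: "\<forall>F. finite F \<longrightarrow> F \<subseteq> J \<longrightarrow> (\<exists>S. fd_regular S \<and> S \<subseteq> J \<and> F \<subseteq> S)"
    and LJ: "locally_fd_regular_mod J"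
  shows "ideal A I \<Longrightarrow> I \<subseteq> J \<Longrightarrow> \<forall>x\<in>J. \<forall>m>0. apow A x m \<in> I \<longrightarrow> apow A x (Suc N) \<in> I \<Longrightarrow>
    locally_fd_regular_mod I"
proof (induction N arbitrary: I)
  case 0
  then show ?case using central_descent_step [OF J locJ, of I 0] LJ by metis
next
  case (Suc N)
  obtain I' where "ideal A I'" "I' \<subseteq> J"
    "\<forall>x\<in>J. \<forall>m>0. apow A x m \<in> I' \<longrightarrow> apow A x (Suc N) \<in> I'"
    "locally_fd_regular_mod I' \<Longrightarrow> locally_fd_regular_mod I"
    using central_descent_step [OF J locJ Suc.prems] by (metis zero_less_Suc)
  then show ?case using Suc.IH by blast
qed

section \<open>Index of nilpotence of an extension, and assembly\<close>

lemma apow_add: "x \<in> C \<Longrightarrow> apow A x (Suc m + Suc n) = apow A x (Suc m) \<odot> apow A x (Suc n)"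
proof (induction m)
  case (Suc m)
  then show ?case using apow_closed [of x "Suc m"] apow_closed [of x "Suc n"] by (simp add: mul_assoc del: apow_closed)
qed simp

lemma apow_mult: "x \<in> C \<Longrightarrow> apow A x (Suc m * Suc n) = apow A (apow A x (Suc m)) (Suc n)"
proof (induction n)
  case (Suc n)
  obtain k where k: "Suc m * Suc n = Suc k" by simp
  have "apow A x (Suc m * Suc (Suc n)) = apow A x (Suc m + Suc k)" using k by simp
  also have "\<dots> = apow A x (Suc m) \<odot> apow A x (Suc k)" by (rule apow_add [OF Suc.prems])
  finally show ?case using Suc k by simp
qed simp

lemma apow_restr: "apow (restr A S) x k = apow A x k"
  by (induction A x k rule: apow.induct) auto

text \<open>Indices multiply: the bound in the quotient puts x^n into \<open>J\<close>, and the
  bound in \<open>J\<close> then kills its m-th power.\<close>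

lemma bounded_nil_index_extension:
  assumes J: "ideal A J" and bJ: "bounded_nil_index (restr A J)" and bQ: "bounded_nil_index (quot A J)"
  shows "bounded_nil_index A"
proof -
  interpret h: alg_homomorphism A "quot A J" "cos A J" by (rule quot_hom [OF J])
  obtain m where m: "m > 0" "\<And>x. x \<in> J \<Longrightarrow> nilpotent_elt A x \<Longrightarrow> apow A x m = \<zero>"
    using bJ unfolding bounded_nil_index_def nilpotent_elt_def by (auto simp: apow_restr)
  obtain n where n: "n > 0"
    "\<And>X. X \<in> carr (quot A J) \<Longrightarrow> nilpotent_elt (quot A J) X \<Longrightarrow> apow (quot A J) X n = zro (quot A J)"
    using bQ unfolding bounded_nil_index_def by blast
  obtain m' n' where mn: "m = Suc m'" "n = Suc n'" using m n gr0_conv_Suc by metis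
  have "apow A x (n * m) = \<zero>" if x: "x \<in> C" "nilpotent_elt A x" for x
  proof -
    obtain k where k: "k > 0" "apow A x k = \<zero>" using x unfolding nilpotent_elt_def by auto
    have "apow (quot A J) (cos A J x) k = zro (quot A J)" using k x by (simp flip: h.hom_apow)
    then have "apow (quot A J) (cos A J x) n = zro (quot A J)"
      using n(2) [of "cos A J x"] x(1) k(1) unfolding nilpotent_elt_def quot_carr by blast
    then have xn: "apow A x n \<in> J" using x cos_eq_zero_iff [OF J] by (simp flip: h.hom_apow)
    obtain k' where k': "k = Suc k'" using k gr0_conv_Suc by auto
    \<comment> \<open>The bound in \<open>J\<close> needs x^n to be nilpotent itself, which follows
      by exchanging the two exponents.\<close>
    have "apow A (apow A x n) k = apow A x (n * k)" unfolding mn k' by (rule apow_mult [OF x(1), symmetric])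
    also have "\<dots> = apow A x (k * n)" by (simp only: mult.commute)
    also have "\<dots> = apow A (apow A x k) n" unfolding mn k' by (rule apow_mult [OF x(1)])
    also have "\<dots> = \<zero>" unfolding k mn by (cases n') auto
    finally have "nilpotent_elt A (apow A x n)" using k unfolding nilpotent_elt_def by blast
    then have "apow A (apow A x n) m = \<zero>" by (rule m(2) [OF xn])
    then show ?thesis using apow_mult [OF x(1), of n' m'] mn by simp
  qed
  then show ?thesis unfolding bounded_nil_index_def using m n by (intro exI [of _ "n * m"]) auto
qed

lemma locally_fdss_extension:
  assumes J: "ideal A J" and lJ: "locally_fdss (restr A J)" and bJ: "bounded_nil_index (restr A J)"
    and lQ: "locally_fdss (quot A J)"
  shows "locally_fdss A"
proof -
  interpret Q: k_algebra "quot A J" by (rule quot_k_algebra [OF J])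
  interpret h: alg_homomorphism A "quot A J" "cos A J" by (rule quot_hom [OF J])
  have "locally_fd_regular_mod {x \<in> C. cos A J x \<in> {zro (quot A J)}}"
    using lQ unfolding Q.locally_fdss_iff
    by (rule h.locally_fd_regular_mod_preimage [OF quot_carr [symmetric]])
  moreover have "{x \<in> C. cos A J x \<in> {zro (quot A J)}} = J"
    using cos_eq_zero_iff [OF J] idealD(3) [OF J] by auto
  ultimately have LJ: "locally_fd_regular_mod J" by simp
  have "\<exists>S. fd_regular S \<and> S \<subseteq> J \<and> F \<subseteq> S" if F: "finite F" "F \<subseteq> J" for F
  proof -
    obtain S where S: "subalg (restr A J) S" "F \<subseteq> S" "fd_semisimple (restr A S)"
      using lJ F unfolding locally_fdss_def by auto
    then have "subalg A S" "S \<subseteq> J" using idealD(3) [OF J] by (auto simp: subalg_def)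
    then show ?thesis using S fd_semisimple_restr by blast
  qed
  then have locJ: "\<forall>F. finite F \<longrightarrow> F \<subseteq> J \<longrightarrow> (\<exists>S. fd_regular S \<and> S \<subseteq> J \<and> F \<subseteq> S)" by simp
  obtain m where m: "m > 0" "\<And>x. x \<in> J \<Longrightarrow> nilpotent_elt A x \<Longrightarrow> apow A x m = \<zero>"
    using bJ unfolding bounded_nil_index_def nilpotent_elt_def by (auto simp: apow_restr)
  have "ideal A {\<zero>}" by (intro idealI) (auto simp: subspace_def)
  moreover have "{\<zero>} \<subseteq> J" using subspaceD(2) [OF idealD(2) [OF J]] by auto
  \<comment> \<open>Modulo the zero ideal the condition on powers is the index bound of
    \<open>J\<close>. The descent counts from \<open>Suc N\<close>, so the positive bound m enters
    as N = m - 1.\<close>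
  moreover have "\<forall>x\<in>J. \<forall>k>0. apow A x k \<in> {\<zero>} \<longrightarrow> apow A x (Suc (m - 1)) \<in> {\<zero>}"
    using m unfolding nilpotent_elt_def by auto
  ultimately show ?thesis
    unfolding locally_fdss_iff by (rule locally_fd_regular_mod_descent [OF J locJ LJ])
qed

end

theorem theorem4p9:
  fixes R :: "('k::field, 'a) kalg" and J :: "'a set"
  assumes "is_kalg R"
    and "ideal R J"
    and "locally_fdss (restr R J)" and "bounded_nil_index (restr R J)"
    and "locally_fdss (quot R J)" and "bounded_nil_index (quot R J)"
  shows "locally_fdss R \<and> bounded_nil_index R"
proof -
  interpret k_algebra R by unfold_locales (rule assms(1))
  show ?thesis
    using locally_fdss_extension [OF assms(2-5)] bounded_nil_index_extension [OF assms(2,4,6)] ..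
qed

end
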